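(* The partition and assign problem (defined in the context) can be solved in $O(nk)$ time.
   Context: Partition and assign problem: given $k$ thresholds $w_0^{(1)},\ldots,w_0^{(k)}$ and $k$ coefficients $c_1,\ldots,c_k$, and $n$ jobs $1,\ldots,n$ to process in order, where job $i$ is associated with $(w_i,s_i)$; all parameters are nonnegative. A group of consecutive jobs $i,\ldots,j$ can be processed in a batch by an agent of type $a\in\{1,\ldots,k\}$ if $w_i+\cdots+w_j\le w_0^{(a)}$, and the cost is then $c_a\cdot\max\{s_i,\ldots,s_j\}$. The task is to find a partition of $1,\ldots,n$ into consecutive groups and an assignment of an agent type to each group (respecting the weight condition) minimizing the total cost. Arithmetic operations and comparisons take $O(1)$ time. *)

theory Defs
  imports Complex_Main "HOL-Library.Disjoint_Sets"
begin

section \<open>The problem\<close>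

text \<open>Jobs are numbered from 1 to \<open>njobs\<close> and agent types from 1 to \<open>ntypes\<close>; the functions are
  meaningful only on these ranges.\<close>

record inst =
  njobs :: nat
  ntypes :: nat
  threshold :: "nat \<Rightarrow> real"
  coeff :: "nat \<Rightarrow> real"
  weight :: "nat \<Rightarrow> real"
  sval :: "nat \<Rightarrow> real"

definition nonneg_inst :: "inst \<Rightarrow> bool" where
  "nonneg_inst I \<longleftrightarrow>
     (\<forall>a\<in>{1..ntypes I}. 0 \<le> threshold I a \<and> 0 \<le> coeff I a) \<and>
     (\<forall>i\<in>{1..njobs I}. 0 \<le> weight I i \<and> 0 \<le> sval I i)"

text \<open>A candidate solution is a partition \<open>P\<close> of the jobs into intervals, together with a map \<open>\<alpha>\<close>
  that gives each group of \<open>P\<close> its agent type.\<close>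

definition valid_solution :: "inst \<Rightarrow> nat set set \<Rightarrow> (nat set \<Rightarrow> nat) \<Rightarrow> bool" where
  "valid_solution I P \<alpha> \<longleftrightarrow>
     partition_on {1..njobs I} P \<and>
     (\<forall>B\<in>P. \<exists>i j. B = {i..j}) \<and>
     (\<forall>B\<in>P. \<alpha> B \<in> {1..ntypes I} \<and> (\<Sum>i\<in>B. weight I i) \<le> threshold I (\<alpha> B))"

definition total_cost :: "inst \<Rightarrow> nat set set \<Rightarrow> (nat set \<Rightarrow> nat) \<Rightarrow> real" where
  "total_cost I P \<alpha> = (\<Sum>B\<in>P. coeff I (\<alpha> B) * Max (sval I ` B))"

definition optimal_solution :: "inst \<Rightarrow> nat set set \<Rightarrow> (nat set \<Rightarrow> nat) \<Rightarrow> bool" where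
  "optimal_solution I P \<alpha> \<longleftrightarrow>
     valid_solution I P \<alpha> \<and>
     (\<forall>P' \<alpha>'. valid_solution I P' \<alpha>' \<longrightarrow> total_cost I P \<alpha> \<le> total_cost I P' \<alpha>')"

section \<open>The model of computation\<close>

text \<open>A unit-cost real RAM, programmed in a structured language. Memory consists of named,
  unbounded arrays of two sorts: natural numbers (used for indices and addresses) and reals (used
  for the data); a scalar variable is cell 0 of its array. Every arithmetic operation, comparison,
  memory access, constant and test costs one time unit.

  The instruction set is deliberately small, so that a time bound proved here also holds in richer
  models: naturals can only be added, subtracted (with truncation at 0) and compared, so that unit
  cost does not hide the processing of large integers; there are no conversions between the sorts,
  in particular no rounding; and the only real literals are integers, so that a program cannot
  carry infinite information.\<close>

type_synonym vname = string

record state =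
  nmem :: "vname \<Rightarrow> nat \<Rightarrow> nat"
  rmem :: "vname \<Rightarrow> nat \<Rightarrow> real"

datatype nexp =
    NConst nat
  | NGet vname nexp
  | NPlus nexp nexp
  | NMinus nexp nexp

datatype rexp =
    RConst int
  | RGet vname nexp
  | RPlus rexp rexp
  | RMinus rexp rexp
  | RTimes rexp rexp

datatype bexp =
    NLess nexp nexp
  | RLess rexp rexp
  | BNot bexp
  | BAnd bexp bexp

datatype com =
    Skip
  | NSet vname nexp nexp
  | RSet vname nexp rexp
  | Seq com com
  | Cond bexp com com
  | While bexp com

primrec nval :: "nexp \<Rightarrow> state \<Rightarrow> nat" where
  "nval (NConst m) \<sigma> = m"
| "nval (NGet x e) \<sigma> = nmem \<sigma> x (nval e \<sigma>)"
| "nval (NPlus e f) \<sigma> = nval e \<sigma> + nval f \<sigma>"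
| "nval (NMinus e f) \<sigma> = nval e \<sigma> - nval f \<sigma>"

primrec rval :: "rexp \<Rightarrow> state \<Rightarrow> real" where
  "rval (RConst z) \<sigma> = of_int z"
| "rval (RGet x e) \<sigma> = rmem \<sigma> x (nval e \<sigma>)"
| "rval (RPlus e f) \<sigma> = rval e \<sigma> + rval f \<sigma>"
| "rval (RMinus e f) \<sigma> = rval e \<sigma> - rval f \<sigma>"
| "rval (RTimes e f) \<sigma> = rval e \<sigma> * rval f \<sigma>"

primrec bval :: "bexp \<Rightarrow> state \<Rightarrow> bool" where
  "bval (NLess e f) \<sigma> \<longleftrightarrow> nval e \<sigma> < nval f \<sigma>"
| "bval (RLess e f) \<sigma> \<longleftrightarrow> rval e \<sigma> < rval f \<sigma>"
| "bval (BNot b) \<sigma> \<longleftrightarrow> \<not> bval b \<sigma>"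
| "bval (BAnd b d) \<sigma> \<longleftrightarrow> bval b \<sigma> \<and> bval d \<sigma>"

primrec ntime :: "nexp \<Rightarrow> nat" where
  "ntime (NConst m) = 1"
| "ntime (NGet x e) = 1 + ntime e"
| "ntime (NPlus e f) = 1 + ntime e + ntime f"
| "ntime (NMinus e f) = 1 + ntime e + ntime f"

primrec rtime :: "rexp \<Rightarrow> nat" where
  "rtime (RConst z) = 1"
| "rtime (RGet x e) = 1 + ntime e"
| "rtime (RPlus e f) = 1 + rtime e + rtime f"
| "rtime (RMinus e f) = 1 + rtime e + rtime f"
| "rtime (RTimes e f) = 1 + rtime e + rtime f"

primrec btime :: "bexp \<Rightarrow> nat" where
  "btime (NLess e f) = 1 + ntime e + ntime f"
| "btime (RLess e f) = 1 + rtime e + rtime f"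
| "btime (BNot b) = 1 + btime b"
| "btime (BAnd b d) = 1 + btime b + btime d"

definition nupd :: "vname \<Rightarrow> nat \<Rightarrow> nat \<Rightarrow> state \<Rightarrow> state" where
  "nupd x i m \<sigma> = \<sigma>\<lparr>nmem := (nmem \<sigma>)(x := (nmem \<sigma> x)(i := m))\<rparr>"

definition rupd :: "vname \<Rightarrow> nat \<Rightarrow> real \<Rightarrow> state \<Rightarrow> state" where
  "rupd x i r \<sigma> = \<sigma>\<lparr>rmem := (rmem \<sigma>)(x := (rmem \<sigma> x)(i := r))\<rparr>"

text \<open>\<open>exec c \<sigma> t \<tau>\<close>: started in \<open>\<sigma>\<close>, the program \<open>c\<close> terminates after exactly \<open>t\<close> time units
  in \<open>\<tau>\<close>.\<close>

inductive exec :: "com \<Rightarrow> state \<Rightarrow> nat \<Rightarrow> state \<Rightarrow> bool" where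
  Skip: "exec Skip \<sigma> 1 \<sigma>"
| NSet: "exec (NSet x e f) \<sigma> (1 + ntime e + ntime f) (nupd x (nval e \<sigma>) (nval f \<sigma>) \<sigma>)"
| RSet: "exec (RSet x e f) \<sigma> (1 + ntime e + rtime f) (rupd x (nval e \<sigma>) (rval f \<sigma>) \<sigma>)"
| Seq: "exec c \<sigma> t \<sigma>' \<Longrightarrow> exec d \<sigma>' u \<tau> \<Longrightarrow> exec (Seq c d) \<sigma> (t + u) \<tau>"
| CondTrue: "bval b \<sigma> \<Longrightarrow> exec c \<sigma> t \<tau> \<Longrightarrow> exec (Cond b c d) \<sigma> (1 + btime b + t) \<tau>"
| CondFalse: "\<not> bval b \<sigma> \<Longrightarrow> exec d \<sigma> t \<tau> \<Longrightarrow> exec (Cond b c d) \<sigma> (1 + btime b + t) \<tau>"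
| WhileFalse: "\<not> bval b \<sigma> \<Longrightarrow> exec (While b c) \<sigma> (1 + btime b) \<sigma>"
| WhileTrue: "bval b \<sigma> \<Longrightarrow> exec c \<sigma> t \<sigma>' \<Longrightarrow> exec (While b c) \<sigma>' u \<tau> \<Longrightarrow>
    exec (While b c) \<sigma> (1 + btime b + t + u) \<tau>"

inductive_cases exec_SkipE: "exec Skip \<sigma> t \<tau>"
inductive_cases exec_NSetE: "exec (NSet x e f) \<sigma> t \<tau>"
inductive_cases exec_RSetE: "exec (RSet x e f) \<sigma> t \<tau>"
inductive_cases exec_SeqE: "exec (Seq c d) \<sigma> t \<tau>"
inductive_cases exec_CondE: "exec (Cond b c d) \<sigma> t \<tau>"
inductive_cases exec_WhileE: "exec (While b c) \<sigma> t \<tau>"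

lemma exec_deterministic:
  "exec c \<sigma> t \<tau> \<Longrightarrow> exec c \<sigma> t' \<tau>' \<Longrightarrow> t' = t \<and> \<tau>' = \<tau>"
proof (induction arbitrary: t' \<tau>' rule: exec.induct)
  case (Skip \<sigma>)
  then show ?case by (elim exec_SkipE) simp
next
  case (NSet x e f \<sigma>)
  then show ?case by (elim exec_NSetE) simp
next
  case (RSet x e f \<sigma>)
  then show ?case by (elim exec_RSetE) simp
next
  case (Seq c \<sigma> t \<sigma>' d u \<tau>)
  from Seq.prems obtain t1 \<sigma>1 u1
    where *: "t' = t1 + u1" "exec c \<sigma> t1 \<sigma>1" "exec d \<sigma>1 u1 \<tau>'"
    by (rule exec_SeqE)
  from Seq.IH(1)[OF *(2)] Seq.IH(2)[of u1 \<tau>'] * show ?case by simp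
next
  case (CondTrue b \<sigma> c t \<tau> d)
  from CondTrue.prems obtain t1 where *: "t' = Suc (btime b + t1)" "exec c \<sigma> t1 \<tau>'"
    by (rule exec_CondE) (use CondTrue.hyps in simp_all)
  from CondTrue.IH[OF *(2)] *(1) show ?case by simp
next
  case (CondFalse b \<sigma> d t \<tau> c)
  from CondFalse.prems obtain t1 where *: "t' = Suc (btime b + t1)" "exec d \<sigma> t1 \<tau>'"
    by (rule exec_CondE) (use CondFalse.hyps in simp_all)
  from CondFalse.IH[OF *(2)] *(1) show ?case by simp
next
  case (WhileFalse b \<sigma> c)
  from WhileFalse.prems show ?case
    by (rule exec_WhileE) (use WhileFalse.hyps in simp_all)
next
  case (WhileTrue b \<sigma> c t \<sigma>' u \<tau>)
  from WhileTrue.prems obtain t1 \<sigma>1 u1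
    where *: "t' = Suc (btime b + t1 + u1)" "exec c \<sigma> t1 \<sigma>1" "exec (While b c) \<sigma>1 u1 \<tau>'"
    by (rule exec_WhileE) (use WhileTrue.hyps in simp_all)
  from WhileTrue.IH(1)[OF *(2)] WhileTrue.IH(2)[of u1 \<tau>'] * show ?case by simp
qed

section \<open>Input and output\<close>

text \<open>The input occupies the arrays named below; all other cells are initially 0.\<close>

definition initial_state :: "inst \<Rightarrow> state" where
  "initial_state I = \<lparr>
     nmem = (\<lambda>x i.
       if x = ''n'' \<and> i = 0 then njobs I
       else if x = ''k'' \<and> i = 0 then ntypes I
       else 0),
     rmem = (\<lambda>x i.
       if x = ''w0'' \<and> i \<in> {1..ntypes I} then threshold I i
       else if x = ''c'' \<and> i \<in> {1..ntypes I} then coeff I i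
       else if x = ''w'' \<and> i \<in> {1..njobs I} then weight I i
       else if x = ''s'' \<and> i \<in> {1..njobs I} then sval I i
       else 0)\<rparr>"

text \<open>The output gives the number \<open>m\<close> of groups, the position \<open>e g\<close> of the last job of group
  \<open>g\<close> (with \<open>e 0 = 0\<close>), and the agent type of group \<open>g\<close>, for \<open>1 \<le> g \<le> m\<close>.\<close>

definition output_solution :: "state \<Rightarrow> nat set set \<Rightarrow> (nat set \<Rightarrow> nat) \<Rightarrow> bool" where
  "output_solution \<tau> P \<alpha> \<longleftrightarrow>
     (let m = nmem \<tau> ''groups'' 0;
          e = nmem \<tau> ''last'';
          block = (\<lambda>g. {e (g - 1)<..e g})
      in P = block ` {1..m} \<and> (\<forall>g\<in>{1..m}. \<alpha> (block g) = nmem \<tau> ''type'' g))"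

text \<open>Since no valid solution exists if some job is too heavy for every agent type, the output also
  contains a flag that tells whether there is one.\<close>

definition correct_output :: "inst \<Rightarrow> state \<Rightarrow> bool" where
  "correct_output I \<tau> \<longleftrightarrow>
     (if \<exists>P \<alpha>. valid_solution I P \<alpha>
      then nmem \<tau> ''feasible'' 0 = 1 \<and> (\<exists>P \<alpha>. output_solution \<tau> P \<alpha> \<and> optimal_solution I P \<alpha>)
      else nmem \<tau> ''feasible'' 0 = 0)"

definition solves_within :: "com \<Rightarrow> (nat \<Rightarrow> nat \<Rightarrow> nat) \<Rightarrow> bool" where
  "solves_within prog T \<longleftrightarrow>
     (\<forall>I. nonneg_inst I \<longrightarrow>
       (\<exists>t \<tau>. exec prog (initial_state I) t \<tau> \<and> t \<le> T (njobs I) (ntypes I) \<and> correct_output I \<tau>))"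

end

theory Submission
  imports Defs
begin

text \<open>Let \<open>D j\<close> be the optimal cost of the last \<open>j\<close> jobs, numbered backwards, and let \<open>M i j\<close> be the
  maximum of \<open>s\<close> over \<open>{i<..j}\<close>. Then \<open>D j\<close> is the minimum of \<open>D i + c a * M i j\<close> over all types \<open>a\<close>
  and all \<open>i < j\<close> such that \<open>{i<..j}\<close> is light enough for \<open>a\<close>, and \<open>D\<close> is monotone. For each type the
  admissible \<open>i\<close> form a sliding window, whose minimum has to be maintained in amortized constant time.
  The positions are divided into phases. If a phase consists of \<open>m, ..., e\<close>, then \<open>e\<close> is the last
  position whose window reaches to the left of \<open>m\<close> (or \<open>e = m\<close>).

  A candidate \<open>i \<ge> m\<close> never leaves the window during the phase. So the minimum over these candidates
  for \<open>j\<close> is computed from the one for \<open>p\<close>, where \<open>p\<close> is the last position before \<open>j\<close> with \<open>s p > s j\<close>: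
  for \<open>i \<ge> p\<close> the maximum is \<open>s j\<close> and by monotonicity the leftmost \<open>i\<close> is best, and for \<open>i < p\<close> the
  maximum does not change.

  For a candidate \<open>i < m\<close> the maximum is \<open>max (M i m) (M m j)\<close>. If \<open>M i m < M m j\<close>, again the leftmost
  such \<open>i\<close> is best. The other candidates in the window form an interval that shrinks at both ends
  when \<open>j\<close> grows. Since all of \<open>D 0, ..., D (m - 1)\<close> are known when the phase starts, the minima over
  these intervals are computed then, for \<open>j = e, ..., m\<close> in reverse order, so that the interval only
  grows. Each phase starts right after the previous one and its windows do not extend to the left of
  the previous \<open>m\<close>, so all phases of one type take linear time.

  Finally, a scan over all \<open>i\<close> and \<open>a\<close> recovers an optimal solution from the values of \<open>D\<close>.\<close>

section \<open>Weakest preconditions with a clock\<close>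

text \<open>The clock \<open>t\<close> shows the time at which the program starts; the postcondition sees the time at
  which it ends.\<close>

definition wp :: "com \<Rightarrow> (state \<Rightarrow> nat \<Rightarrow> bool) \<Rightarrow> state \<Rightarrow> nat \<Rightarrow> bool" where
  "wp p Q \<sigma> t \<longleftrightarrow> (\<exists>u \<tau>. exec p \<sigma> u \<tau> \<and> Q \<tau> (t + u))"

primrec nwrites :: "com \<Rightarrow> vname set" where
  "nwrites Skip = {}"
| "nwrites (NSet x e f) = {x}"
| "nwrites (RSet x e f) = {}"
| "nwrites (Seq p q) = nwrites p \<union> nwrites q"
| "nwrites (Cond b p q) = nwrites p \<union> nwrites q"
| "nwrites (While b p) = nwrites p"

primrec rwrites :: "com \<Rightarrow> vname set" where
  "rwrites Skip = {}"
| "rwrites (NSet x e f) = {}"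
| "rwrites (RSet x e f) = {x}"
| "rwrites (Seq p q) = rwrites p \<union> rwrites q"
| "rwrites (Cond b p q) = rwrites p \<union> rwrites q"
| "rwrites (While b p) = rwrites p"

text \<open>Arrays that a program never writes keep their contents. Specifications therefore mention
  only what changes, and the frame carries the rest across a subprogram.\<close>

definition frame :: "com \<Rightarrow> state \<Rightarrow> state \<Rightarrow> bool" where
  "frame p \<sigma> \<tau> \<longleftrightarrow> (\<forall>x. x \<notin> nwrites p \<longrightarrow> nmem \<tau> x = nmem \<sigma> x) \<and>
     (\<forall>x. x \<notin> rwrites p \<longrightarrow> rmem \<tau> x = rmem \<sigma> x)"

lemma nmem_nupd [simp]: "nmem (nupd x i m \<sigma>) = (nmem \<sigma>)(x := (nmem \<sigma> x)(i := m))"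
  and rmem_nupd [simp]: "rmem (nupd x i m \<sigma>) = rmem \<sigma>"
  and nmem_rupd [simp]: "nmem (rupd x i r \<sigma>) = nmem \<sigma>"
  and rmem_rupd [simp]: "rmem (rupd x i r \<sigma>) = (rmem \<sigma>)(x := (rmem \<sigma> x)(i := r))"
  by (simp_all add: nupd_def rupd_def)

lemma exec_frame: "exec p \<sigma> t \<tau> \<Longrightarrow> frame p \<sigma> \<tau>"
  by (induction rule: exec.induct) (auto simp: frame_def)

text \<open>Determinism of \<open>exec\<close> gives an equivalence here and for assignments. With
  the rules for \<open>Seq\<close> and \<open>Cond\<close>, simplification executes loop-free
  programs symbolically, clock included.\<close>

lemma wp_Skip [simp]: "wp Skip Q \<sigma> t \<longleftrightarrow> Q \<sigma> (t + 1)"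
  unfolding wp_def by (metis exec.Skip exec_deterministic)

lemma wp_NSet [simp]:
  "wp (NSet x e f) Q \<sigma> t \<longleftrightarrow>
     Q (nupd x (nval e \<sigma>) (nval f \<sigma>) \<sigma>) (t + (1 + ntime e + ntime f))"
  unfolding wp_def by (metis exec.NSet exec_deterministic)

lemma wp_RSet [simp]:
  "wp (RSet x e f) Q \<sigma> t \<longleftrightarrow>
     Q (rupd x (nval e \<sigma>) (rval f \<sigma>) \<sigma>) (t + (1 + ntime e + rtime f))"
  unfolding wp_def by (metis exec.RSet exec_deterministic)

lemma wp_Seq [simp]: "wp (Seq p q) Q \<sigma> t \<longleftrightarrow> wp p (wp q Q) \<sigma> t"
proof
  assume "wp (Seq p q) Q \<sigma> t"
  then show "wp p (wp q Q) \<sigma> t"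
    unfolding wp_def by (metis exec_SeqE add.assoc)
next
  assume "wp p (wp q Q) \<sigma> t"
  then show "wp (Seq p q) Q \<sigma> t"
    unfolding wp_def by (metis exec.Seq add.assoc)
qed

lemma wp_Cond [simp]:
  "wp (Cond b p q) Q \<sigma> t \<longleftrightarrow>
     (if bval b \<sigma> then wp p Q \<sigma> (t + (1 + btime b)) else wp q Q \<sigma> (t + (1 + btime b)))"
proof (cases "bval b \<sigma>")
  case True
  have "exec (Cond b p q) \<sigma> u \<tau> \<longleftrightarrow> (\<exists>v. u = 1 + btime b + v \<and> exec p \<sigma> v \<tau>)" for u \<tau>
    using True by (auto elim: exec_CondE intro: exec.CondTrue[of b, simplified])
  with True show ?thesis unfolding wp_def by (simp add: add.assoc) (metis add.assoc add_Suc_right)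
next
  case False
  have "exec (Cond b p q) \<sigma> u \<tau> \<longleftrightarrow> (\<exists>v. u = 1 + btime b + v \<and> exec q \<sigma> v \<tau>)" for u \<tau>
    using False by (auto elim: exec_CondE intro: exec.CondFalse[of b, simplified])
  with False show ?thesis unfolding wp_def by (simp add: add.assoc) (metis add.assoc add_Suc_right)
qed

text \<open>Besides weakening the postcondition, the rule hands over the frame of the program just
  executed.\<close>

lemma wp_conseq:
  assumes "wp p Q \<sigma> t" "\<And>\<tau> u. Q \<tau> u \<Longrightarrow> frame p \<sigma> \<tau> \<Longrightarrow> Q' \<tau> u"
  shows "wp p Q' \<sigma> t"
  using assms exec_frame unfolding wp_def by blast

text \<open>Every iteration advances the clock, so a bound \<open>N\<close> on the clock under the invariant
  yields termination.\<close>

lemma wp_While: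
  assumes init: "J \<sigma> t"
    and bound: "\<And>\<tau> u. J \<tau> u \<Longrightarrow> u \<le> N"
    and body: "\<And>\<tau> u. J \<tau> u \<Longrightarrow> bval b \<tau> \<Longrightarrow> wp p J \<tau> (u + (1 + btime b))"
    and exit: "\<And>\<tau> u. J \<tau> u \<Longrightarrow> \<not> bval b \<tau> \<Longrightarrow> Q \<tau> (u + (1 + btime b))"
  shows "wp (While b p) Q \<sigma> t"
proof -
  have "J \<tau> u \<Longrightarrow> wp (While b p) Q \<tau> u" for \<tau> u
  proof (induction "N - u" arbitrary: \<tau> u rule: less_induct)
    case less
    show ?case
    proof (cases "bval b \<tau>")
      case False
      with less.prems exit show ?thesis
        unfolding wp_def by (blast intro: exec.WhileFalse)
    next
      case True
      with body less.prems obtain v \<tau>'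
        where v: "exec p \<tau> v \<tau>'" "J \<tau>' (u + (1 + btime b) + v)"
        unfolding wp_def by blast
      have "N - (u + (1 + btime b) + v) < N - u"
        using bound[OF less.prems] bound[OF v(2)] by simp
      from less.hyps[OF this v(2)] obtain y \<tau>''
        where y: "exec (While b p) \<tau>' y \<tau>''" "Q \<tau>'' (u + (1 + btime b) + v + y)"
        unfolding wp_def by blast
      from exec.WhileTrue[OF True v(1) y(1)] y(2) show ?thesis
        unfolding wp_def by (intro exI conjI) (assumption, simp add: add.assoc)
    qed
  qed
  with init show ?thesis by blast
qed

section \<open>The recurrence\<close>

text \<open>The signs are required at all indices, not only on the ranges, which spares side
  conditions later.\<close>

locale jobs =
  fixes n k :: nat and W c w s :: "nat \<Rightarrow> real"
  assumes W_nonneg: "0 \<le> W a" and c_nonneg: "0 \<le> c a"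
    and w_nonneg: "0 \<le> w j" and s_nonneg: "0 \<le> s j"
begin

definition psum :: "nat \<Rightarrow> real" where
  "psum j = sum w {1..j}"

text \<open>The 0 gives the empty segment the maximum 0; since \<open>s\<close> is nonnegative, no
  other maximum changes.\<close>

definition mx :: "nat \<Rightarrow> nat \<Rightarrow> real" where
  "mx i j = Max (insert 0 (s ` {i<..j}))"

text \<open>An upper bound on all finite costs; it serves as the minimum of an empty set of candidates.\<close>

definition top_cost :: real where
  "top_cost = sum c {1..k} * sum s {1..n}"

definition cmin :: "('a \<Rightarrow> real) \<Rightarrow> 'a set \<Rightarrow> real" where
  "cmin f S = Min (insert top_cost (f ` S))"

text \<open>As a congruence rule it gives the termination proof of \<open>opt\<close> the bound
  \<open>i < j\<close> on recursive arguments.\<close>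

lemma cmin_cong [fundef_cong]:
  "S = S' \<Longrightarrow> (\<And>x. x \<in> S' \<Longrightarrow> f x = g x) \<Longrightarrow> cmin f S = cmin g S'"
  unfolding cmin_def by (metis image_cong)

text \<open>The value D of the recurrence, capped by \<open>top_cost\<close> so that it is defined
  for every instance. On feasible instances the cap is harmless: \<open>opt_attained\<close>
  exhibits a genuine group.\<close>

function opt :: "nat \<Rightarrow> real" where
  "opt j = (if j = 0 then 0 else
     cmin (\<lambda>a. cmin (\<lambda>i. opt i + c a * mx i j) {i. i < j \<and> psum j - psum i \<le> W a}) {1..k})"
  by pat_completeness auto
termination
  by (relation "measure id") auto

declare opt.simps [simp del]

lemma opt_0 [simp]: "opt 0 = 0"
  by (simp add: opt.simps)

section \<open>Capped minima\<close>

lemma cmin_empty [simp]: "cmin f {} = top_cost"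
  by (simp add: cmin_def)

lemma cmin_le_top: "finite S \<Longrightarrow> cmin f S \<le> top_cost"
  by (simp add: cmin_def)

lemma cmin_le: "finite S \<Longrightarrow> x \<in> S \<Longrightarrow> cmin f S \<le> f x"
  by (simp add: cmin_def)

lemma cmin_ge_iff: "finite S \<Longrightarrow> y \<le> cmin f S \<longleftrightarrow> y \<le> top_cost \<and> (\<forall>x\<in>S. y \<le> f x)"
  by (simp add: cmin_def)

lemma cmin_cases:
  assumes "finite S"
  obtains "cmin f S = top_cost" | x where "x \<in> S" "cmin f S = f x"
proof -
  have "cmin f S \<in> insert top_cost (f ` S)"
    unfolding cmin_def using assms by (intro Min_in) auto
  then show thesis using that by auto
qed

lemma cmin_insert: "finite S \<Longrightarrow> cmin f (insert x S) = min (f x) (cmin f S)"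
  unfolding cmin_def by (simp add: insert_commute)

lemma cmin_Un:
  assumes "finite S" "finite T"
  shows "cmin f (S \<union> T) = min (cmin f S) (cmin f T)"
proof (rule order.antisym)
  show "cmin f (S \<union> T) \<le> min (cmin f S) (cmin f T)"
    using assms by (simp add: cmin_ge_iff cmin_le cmin_le_top)
  show "min (cmin f S) (cmin f T) \<le> cmin f (S \<union> T)"
    using assms by (auto simp: cmin_ge_iff
      intro: cmin_le_top min.coboundedI1 cmin_le[where f = f] min.coboundedI2)
qed

section \<open>Prefix sums and maxima of segments\<close>

lemma psum_Suc: "psum (Suc j) = psum j + w (Suc j)"
  by (simp add: psum_def)

lemma psum_0 [simp]: "psum 0 = 0"
  by (simp add: psum_def)

lemma psum_mono: "i \<le> j \<Longrightarrow> psum i \<le> psum j"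
  unfolding psum_def by (intro sum_mono2) (auto simp: w_nonneg)

lemma psum_diff: "i \<le> j \<Longrightarrow> psum j - psum i = sum w {i<..j}"
proof -
  assume "i \<le> j"
  then have "{1..j} = {1..i} \<union> {i<..j}" by auto
  then have "sum w {1..j} = sum w {1..i} + sum w {i<..j}"
    by (subst sum.union_disjoint[symmetric]) auto
  then show ?thesis by (simp add: psum_def)
qed

lemma mx_le_iff: "mx i j \<le> r \<longleftrightarrow> 0 \<le> r \<and> (\<forall>q. i < q \<and> q \<le> j \<longrightarrow> s q \<le> r)"
  unfolding mx_def by auto

lemma mx_nonneg: "0 \<le> mx i j"
  using mx_le_iff by blast

lemma mx_ge: "i < q \<Longrightarrow> q \<le> j \<Longrightarrow> s q \<le> mx i j"
  using mx_le_iff by blast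

lemma mx_same [simp]: "mx i i = 0"
  by (simp add: mx_def)

lemma mx_split:
  assumes "i \<le> m" "m \<le> j"
  shows "mx i j = max (mx i m) (mx m j)"
proof (rule order.antisym)
  show "mx i j \<le> max (mx i m) (mx m j)"
    unfolding mx_le_iff using mx_nonneg[of i m] mx_ge[of i _ m] mx_ge[of m _ j]
    by (auto simp: le_max_iff_disj) (meson leI)
  show "max (mx i m) (mx m j) \<le> mx i j"
    using assms by (auto simp: mx_le_iff mx_nonneg intro!: mx_ge)
qed

lemma mx_mono: "i' \<le> i \<Longrightarrow> j \<le> j' \<Longrightarrow> mx i j \<le> mx i' j'"
  by (auto simp: mx_le_iff[of i j] mx_nonneg intro!: mx_ge)

lemma mx_one [simp]: "mx j (Suc j) = s (Suc j)"
proof -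
  have "{j<..Suc j} = {Suc j}" by auto
  then show ?thesis by (simp add: mx_def s_nonneg max_absorb2)
qed

lemma mx_Suc: "i \<le> j \<Longrightarrow> mx i (Suc j) = max (mx i j) (s (Suc j))"
  using mx_split[of i j "Suc j"] by simp

lemma mx_step: "i < j \<Longrightarrow> mx i j = max (mx (Suc i) j) (s (Suc i))"
  using mx_split[of i "Suc i" j] by (simp add: max.commute)

section \<open>Candidates before and after the start of a phase\<close>

definition left_min :: "nat \<Rightarrow> nat \<Rightarrow> nat \<Rightarrow> real" where
  "left_min a m j = cmin (\<lambda>i. opt i + c a * mx i j) {i. i < m \<and> psum j - psum i \<le> W a}"

text \<open>There is no weight condition: in a phase that starts at \<open>m\<close>, every
  candidate from \<open>m\<close> on stays light enough, because prefix sums are monotone.\<close>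

definition right_min :: "nat \<Rightarrow> nat \<Rightarrow> nat \<Rightarrow> real" where
  "right_min a m j = cmin (\<lambda>i. opt i + c a * mx i j) {m..<j}"

lemma opt_eq: "0 < j \<Longrightarrow> opt j = cmin (\<lambda>a. left_min a j j) {1..k}"
  by (subst opt.simps) (simp add: left_min_def)

lemma opt_le:
  assumes "a \<in> {1..k}" "i < j" "psum j - psum i \<le> W a"
  shows "opt j \<le> opt i + c a * mx i j"
proof -
  have "opt j \<le> left_min a j j"
    using assms cmin_le[of "{1..k}" a "\<lambda>a. left_min a j j"] by (simp add: opt_eq)
  also have "\<dots> \<le> opt i + c a * mx i j"
    unfolding left_min_def using assms by (intro cmin_le) auto
  finally show ?thesis .
qed

lemma left_min_split:
  assumes "m < j" "psum j - psum m \<le> W a"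
  shows "left_min a j j = min (left_min a m j) (right_min a m j)"
proof -
  have "psum j - psum i \<le> W a" if "m \<le> i" for i
    using assms(2) psum_mono[OF that] by simp
  then have "{i. i < j \<and> psum j - psum i \<le> W a} =
      {i. i < m \<and> psum j - psum i \<le> W a} \<union> {m..<j}"
    using assms(1) by auto
  then show ?thesis
    unfolding left_min_def right_min_def by (simp add: cmin_Un)
qed

text \<open>The value 0 is a sentinel for the case that no earlier position has a greater value;
  equal values are passed over.\<close>

definition prev_greater :: "nat \<Rightarrow> nat \<Rightarrow> bool" where
  "prev_greater j p \<longleftrightarrow> p < j \<and> (\<forall>q. p < q \<and> q < j \<longrightarrow> s q \<le> s j) \<and> (p = 0 \<or> s j < s p)"

lemma mx_prev_greater:
  assumes "prev_greater j p" "p \<le> i" "i < j"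
  shows "mx i j = s j"
proof (rule order.antisym)
  show "mx i j \<le> s j"
    unfolding mx_le_iff
  proof (intro conjI allI impI)
    fix q assume "i < q \<and> q \<le> j"
    with assms show "s q \<le> s j" by (cases "q = j") (auto simp: prev_greater_def)
  qed (simp add: s_nonneg)
  show "s j \<le> mx i j" using assms by (simp add: mx_ge)
qed

end

section \<open>Feasible instances: bounds, attainment and monotonicity of optimal costs\<close>

locale feasible_jobs = jobs +
  assumes feasible: "j \<in> {1..n} \<Longrightarrow> \<exists>a\<in>{1..k}. w j \<le> W a"
begin

lemma c_le_sum: "a \<in> {1..k} \<Longrightarrow> c a \<le> sum c {1..k}"
  by (intro member_le_sum) (auto simp: c_nonneg)

text \<open>The group costs at most the share of \<open>s j\<close> in the product of sums, and
  \<open>s j\<close> is not yet counted in \<open>sum s {1..i}\<close>.\<close>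

lemma step_le:
  assumes "opt i \<le> sum c {1..k} * sum s {1..i}" "a \<in> {1..k}" "i < j" "j \<le> n"
  shows "opt i + c a * s j \<le> sum c {1..k} * sum s {1..j}"
proof -
  have "c a * s j \<le> sum c {1..k} * s j"
    using c_le_sum[OF assms(2)] s_nonneg by (intro mult_right_mono)
  moreover have "sum s {1..i} + s j \<le> sum s {1..j}"
  proof -
    have "sum s {1..i} + s j = sum s (insert j {1..i})"
      using assms(3) by simp
    also have "\<dots> \<le> sum s {1..j}"
      using assms(3) by (intro sum_mono2) (auto simp: s_nonneg)
    finally show ?thesis .
  qed
  then have "sum c {1..k} * (sum s {1..i} + s j) \<le> sum c {1..k} * sum s {1..j}"
    by (intro mult_left_mono sum_nonneg c_nonneg)
  ultimately show ?thesis using assms(1) by (simp add: distrib_left)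
qed

text \<open>Singleton groups, which feasibility permits, cost at most \<open>sum c {1..k}\<close>
  times the value of their job.\<close>

lemma opt_bound: "j \<le> n \<Longrightarrow> opt j \<le> sum c {1..k} * sum s {1..j}"
proof (induction j)
  case 0
  show ?case by simp
next
  case (Suc j)
  obtain a where a: "a \<in> {1..k}" "w (Suc j) \<le> W a"
    using feasible[of "Suc j"] Suc.prems by auto
  have "opt (Suc j) \<le> opt j + c a * s (Suc j)"
    using opt_le[of a j "Suc j"] a by (simp add: psum_Suc)
  also have "\<dots> \<le> sum c {1..k} * sum s {1..Suc j}"
    using Suc a by (intro step_le) auto
  finally show ?case .
qed

text \<open>It keeps the cap of \<open>cmin\<close> from interfering when a minimum is evaluated in
  closed form.\<close>

lemma step_le_top:
  assumes "a \<in> {1..k}" "i < j" "j \<le> n"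
  shows "opt i + c a * s j \<le> top_cost"
proof -
  have "opt i + c a * s j \<le> sum c {1..k} * sum s {1..j}"
    using assms opt_bound[of i] by (intro step_le) auto
  also have "\<dots> \<le> top_cost"
    unfolding top_cost_def using assms
    by (intro mult_left_mono sum_mono2 sum_nonneg) (auto simp: s_nonneg c_nonneg)
  finally show ?thesis .
qed

lemma opt_attained:
  assumes "1 \<le> j" "j \<le> n"
  shows "\<exists>a\<in>{1..k}. \<exists>i<j. psum j - psum i \<le> W a \<and> opt j = opt i + c a * mx i j"
proof (cases "opt j = top_cost")
  \<comment> \<open>A singleton group costs at most the cap, so it attains \<open>opt j\<close> when
    this equals the cap.\<close>
  case True
  obtain a where a: "a \<in> {1..k}" "w j \<le> W a"
    using feasible[of j] assms by auto
  obtain i where i: "j = Suc i" using assms by (cases j) auto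
  have "opt i + c a * mx i j \<le> opt j"
    using step_le_top[of a i j] a assms i True by simp
  moreover have ok: "psum j - psum i \<le> W a" using a i by (simp add: psum_Suc)
  ultimately have "opt j = opt i + c a * mx i j"
    using opt_le[of a i j] a i by simp
  with a ok i show ?thesis by blast
next
  case False
  have "opt j = cmin (\<lambda>a. left_min a j j) {1..k}" using assms by (simp add: opt_eq)
  with False obtain a where a: "a \<in> {1..k}" "opt j = left_min a j j"
    by (metis cmin_cases finite_atLeastAtMost)
  let ?S = "{i. i < j \<and> psum j - psum i \<le> W a}"
  have "finite ?S" by simp
  then obtain i where "i \<in> ?S" "opt j = opt i + c a * mx i j"
    using a False unfolding left_min_def by (metis (no_types, lifting) cmin_cases)
  with a show ?thesis by blast
qed

text \<open>Removing job \<open>j + 1\<close> from an optimal solution shrinks its group or deletes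
  it, and neither raises the cost.\<close>

lemma opt_mono_Suc:
  assumes "Suc j \<le> n"
  shows "opt j \<le> opt (Suc j)"
proof -
  obtain a i where ai: "a \<in> {1..k}" "i < Suc j" "psum (Suc j) - psum i \<le> W a"
      "opt (Suc j) = opt i + c a * mx i (Suc j)"
    using opt_attained[of "Suc j"] assms by auto
  show ?thesis
  proof (cases "i = j")
    case True
    with ai show ?thesis by (simp add: c_nonneg s_nonneg)
  next
    case False
    have "opt j \<le> opt i + c a * mx i j"
      using ai False psum_mono[of j "Suc j"] by (intro opt_le) auto
    also have "\<dots> \<le> opt (Suc j)"
      unfolding ai(4) by (intro add_left_mono mult_left_mono mx_mono c_nonneg) auto
    finally show ?thesis .
  qed
qed

lemma opt_mono: "i \<le> j \<Longrightarrow> j \<le> n \<Longrightarrow> opt i \<le> opt j"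
  by (induction j rule: dec_induct) (auto intro: order_trans opt_mono_Suc)

text \<open>Where the maximum is constant, monotonicity of \<open>opt\<close> makes the leftmost
  candidate best. The witness \<open>j'\<close> shows that its cost does not exceed the cap.\<close>

lemma cmin_flat:
  assumes "a \<in> {1..k}" "l < h" "h \<le> m" "m \<le> j" "j \<le> n" "r \<le> s j'" "m \<le> j'" "j' \<le> n"
    and "\<And>i. l \<le> i \<Longrightarrow> i < h \<Longrightarrow> mx i j = r"
  shows "cmin (\<lambda>i. opt i + c a * mx i j) {l..<h} = opt l + c a * r"
proof (rule order.antisym)
  have "cmin (\<lambda>i. opt i + c a * mx i j) {l..<h} \<le> opt l + c a * mx l j"
    using assms(2) by (intro cmin_le) auto
  then show "cmin (\<lambda>i. opt i + c a * mx i j) {l..<h} \<le> opt l + c a * r"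
    using assms(2,9) by simp
  have "opt l + c a * r \<le> opt l + c a * s j'"
    using assms(6) by (intro add_left_mono mult_left_mono c_nonneg)
  also have "\<dots> \<le> top_cost"
    using assms by (intro step_le_top) auto
  finally have "opt l + c a * r \<le> top_cost" .
  then show "opt l + c a * r \<le> cmin (\<lambda>i. opt i + c a * mx i j) {l..<h}"
    using assms(2-5,9) by (auto simp: cmin_ge_iff intro!: opt_mono)
qed

section \<open>Evaluation of the right and left minima\<close>

lemma right_min_far:
  assumes "prev_greater j p" "p \<le> m" "m < j" "j \<le> n" "a \<in> {1..k}"
  shows "right_min a m j = opt m + c a * s j"
  unfolding right_min_def
  using assms mx_prev_greater[OF assms(1)] by (intro cmin_flat[where j' = j and m = j]) auto

lemma right_min_near:
  assumes "prev_greater j p" "m < p" "j \<le> n" "a \<in> {1..k}"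
  shows "right_min a m j = min (opt p + c a * s j) (right_min a m p)"
proof -
  have p: "p < j" "s j \<le> s p"
    using assms by (auto simp: prev_greater_def)
  have "{m..<j} = {m..<p} \<union> {p..<j}" using assms(2) p by auto
  then have "right_min a m j = min (cmin (\<lambda>i. opt i + c a * mx i j) {m..<p})
      (cmin (\<lambda>i. opt i + c a * mx i j) {p..<j})"
    unfolding right_min_def by (simp add: cmin_Un)
  also have "cmin (\<lambda>i. opt i + c a * mx i j) {p..<j} = opt p + c a * s j"
    using assms p mx_prev_greater[OF assms(1)]
    by (intro cmin_flat[where j' = j and m = j]) auto
  also have "cmin (\<lambda>i. opt i + c a * mx i j) {m..<p} = right_min a m p"
    unfolding right_min_def
  proof (rule cmin_cong)
    \<comment> \<open>Job \<open>p\<close> lies in the segment and its value is at least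
      \<open>s j\<close>, so passing from \<open>p\<close> to \<open>j\<close> leaves the maximum
      unchanged.\<close>
    fix i assume "i \<in> {m..<p}"
    then have "mx i j = max (mx i p) (s j)" "s p \<le> mx i p"
      using mx_split[of i p j] mx_prev_greater[OF assms(1), of p] p by (auto intro: mx_ge)
    then show "opt i + c a * mx i j = opt i + c a * mx i p"
      using p by simp
  qed simp
  finally show ?thesis by (simp add: min.commute)
qed

text \<open>\<open>hi\<close> separates the candidates whose own maximum dominates the one over
  \<open>{m<..j}\<close> from those for which the latter is the total maximum; on the second part
  \<open>cmin_flat\<close> selects \<open>hi\<close>.\<close>

lemma left_min_window:
  assumes "a \<in> {1..k}" "lo \<le> hi" "hi \<le> m" "m \<le> j" "j \<le> n"
    and "{i. i < m \<and> psum j - psum i \<le> W a} = {lo..<m}"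
    and "\<And>x. lo \<le> x \<Longrightarrow> x < hi \<Longrightarrow> mx m j \<le> mx x m"
    and "hi < m \<Longrightarrow> mx hi m < mx m j"
  shows "left_min a m j = (if hi < m
     then min (cmin (\<lambda>x. opt x + c a * mx x m) {lo..<hi}) (opt hi + c a * mx m j)
     else cmin (\<lambda>x. opt x + c a * mx x m) {lo..<hi})"
proof -
  have "{lo..<m} = {lo..<hi} \<union> {hi..<m}" using assms by auto
  then have "left_min a m j = min (cmin (\<lambda>i. opt i + c a * mx i j) {lo..<hi})
      (cmin (\<lambda>i. opt i + c a * mx i j) {hi..<m})"
    unfolding left_min_def assms(6) by (simp add: cmin_Un)
  also have "cmin (\<lambda>i. opt i + c a * mx i j) {lo..<hi} =
      cmin (\<lambda>x. opt x + c a * mx x m) {lo..<hi}"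
  proof (rule cmin_cong)
    fix x assume "x \<in> {lo..<hi}"
    then have "mx x j = mx x m"
      using mx_split[of x m j] assms(3,4) assms(7)[of x] by auto
    then show "opt x + c a * mx x j = opt x + c a * mx x m" by simp
  qed simp
  also have "cmin (\<lambda>i. opt i + c a * mx i j) {hi..<m} = opt hi + c a * mx m j" if "hi < m"
  proof -
    \<comment> \<open>A positive maximum is the value of an actual job and not the default 0; this
      job is the witness for \<open>cmin_flat\<close>.\<close>
    have pos: "0 < mx m j"
      using assms(8)[OF that] mx_nonneg[of hi m] by linarith
    then obtain j' where j': "m < j'" "j' \<le> j" "mx m j \<le> s j'"
    proof -
      have "mx m j \<in> insert 0 (s ` {m<..j})" unfolding mx_def by (intro Max_in) auto
      with pos that show thesis by auto
    qed
    have "mx i j = mx m j" if "hi \<le> i" "i < m" for i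
      using mx_split[of i m j] mx_mono[of hi i m m] assms(4) assms(8) that by auto
    with that j' assms show ?thesis by (intro cmin_flat[where j' = j' and m = m]) auto
  qed
  ultimately show ?thesis
    using assms(3) by (auto simp: min_absorb1 cmin_le_top)
qed

end

section \<open>Partitions and chains of groups\<close>

context jobs
begin

text \<open>The order of the jobs is reversed, so that following the recurrence back from \<open>n\<close> yields the
  groups in the order in which they are output.\<close>

definition represents :: "inst \<Rightarrow> bool" where
  "represents I \<longleftrightarrow> njobs I = n \<and> ntypes I = k \<and>
     (\<forall>a\<in>{1..k}. threshold I a = W a \<and> coeff I a = c a) \<and>
     (\<forall>x\<in>{1..n}. weight I x = w (n + 1 - x) \<and> sval I x = s (n + 1 - x))"

lemma represents_reverse:
  assumes "represents I" "x \<in> {1..n}"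
  shows "weight I (n + 1 - x) = w x" "sval I (n + 1 - x) = s x"
proof -
  have "n + 1 - x \<in> {1..n}" "n + 1 - (n + 1 - x) = x" using assms(2) by auto
  with assms(1) show "weight I (n + 1 - x) = w x" "sval I (n + 1 - x) = s x"
    unfolding represents_def by metis+
qed

lemma bij_betw_reverse:
  assumes "i \<le> j" "j \<le> n"
  shows "bij_betw (\<lambda>x. n + 1 - x) {i<..j} {n - j<..n - i}"
  by (rule bij_betw_byWitness[where f' = "\<lambda>x. n + 1 - x"]) (use assms in auto)

lemma segment_weight:
  assumes "represents I" "i \<le> j" "j \<le> n"
  shows "(\<Sum>x\<in>{n - j<..n - i}. weight I x) = psum j - psum i"
proof -
  have "(\<Sum>x\<in>{n - j<..n - i}. weight I x) = (\<Sum>x\<in>{i<..j}. weight I (n + 1 - x))"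
    by (rule sum.reindex_bij_betw[OF bij_betw_reverse[OF assms(2,3)], symmetric])
  also have "\<dots> = sum w {i<..j}"
    using assms(2,3) represents_reverse[OF assms(1)] by (intro sum.cong) auto
  finally show ?thesis using psum_diff[OF assms(2)] by simp
qed

lemma segment_max:
  assumes "represents I" "i < j" "j \<le> n"
  shows "Max (sval I ` {n - j<..n - i}) = mx i j"
proof -
  have "sval I ` {n - j<..n - i} = (\<lambda>x. sval I (n + 1 - x)) ` {i<..j}"
    using bij_betw_imp_surj_on[OF bij_betw_reverse[of i j]] assms by (simp flip: image_image)
  also have "\<dots> = s ` {i<..j}"
    using assms(2,3) represents_reverse[OF assms(1)] by (intro image_cong) auto
  finally have eq: "sval I ` {n - j<..n - i} = s ` {i<..j}" .
  have "0 \<le> Max (s ` {i<..j})"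
    using assms(2) s_nonneg[of j] by (subst Max_ge_iff) auto
  then show ?thesis
    using assms(2) unfolding eq mx_def by (subst Max_insert) auto
qed

text \<open>Lower bound for all solutions, by induction on the number \<open>j\<close> of remaining
  jobs. The group of the first remaining job is split off; the other groups partition the last
  \<open>i\<close> jobs.\<close>

lemma opt_le_partition:
  assumes "represents I"
  shows "j \<le> n \<Longrightarrow> partition_on {n - j<..n} P \<Longrightarrow> \<forall>B\<in>P. \<exists>x y. B = {x..y} \<Longrightarrow>
    \<forall>B\<in>P. \<alpha> B \<in> {1..k} \<and> (\<Sum>i\<in>B. weight I i) \<le> threshold I (\<alpha> B) \<Longrightarrow>
    opt j \<le> total_cost I P \<alpha>"
proof (induction j arbitrary: P rule: less_induct)
  case (less j)
  have fin: "finite P" using less.prems(2) by (rule finite_elements[rotated]) simp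
  show ?case
  proof (cases "j = 0")
    case True
    then have "P = {}"
      using less.prems(2) by (auto simp: partition_on_def)
    with True show ?thesis by (simp add: total_cost_def)
  next
    case False
    then have "n - j + 1 \<in> {n - j<..n}" using less.prems(1) by simp
    then obtain B where B: "B \<in> P" "n - j + 1 \<in> B"
      using partition_onD1[OF less.prems(2)] by blast
    then have sub: "B \<subseteq> {n - j<..n}"
      using less.prems(2) by (auto simp: partition_on_def)
    obtain x y where xy: "B = {x..y}" using less.prems(3) B(1) by blast
    have "x = n - j + 1" "y \<le> n" "n - j < y"
      using B(2) sub unfolding xy by (auto simp: subset_iff) 
    define i where "i = n - y"
    have i: "i < j" "B = {n - j<..n - i}"
      using \<open>x = _\<close> \<open>y \<le> n\<close> \<open>n - j < y\<close> less.prems(1) by (auto simp: i_def xy)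
    have a: "\<alpha> B \<in> {1..k}" "psum j - psum i \<le> W (\<alpha> B)"
      using less.prems(4) B(1) segment_weight[OF assms, of i j] i less.prems(1) assms
      by (auto simp: represents_def)
    have "disjnt B (\<Union>(P - {B}))"
      using partition_onD2[OF less.prems(2)] B(1) by (auto simp: disjnt_def disjoint_def)
    then have "partition_on ({n - j<..n} - B) (P - {B})"
      using partition_on_insert[of B "P - {B}"] less.prems(2) B(1) by (simp add: insert_absorb)
    moreover have "{n - j<..n} - B = {n - i<..n}"
      using i less.prems(1) by auto
    ultimately have "opt i \<le> total_cost I (P - {B}) \<alpha>"
      using less.prems i(1) by (intro less.IH) auto
    moreover have "opt j \<le> opt i + c (\<alpha> B) * mx i j"
      using a i(1) by (intro opt_le)
    moreover have "coeff I (\<alpha> B) * Max (sval I ` B) = c (\<alpha> B) * mx i j"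
      using segment_max[OF assms i(1) less.prems(1)] i(2) a(1) assms by (simp add: represents_def)
    ultimately show ?thesis
      unfolding total_cost_def by (simp add: sum.remove[OF fin B(1)])
  qed
qed

text \<open>The first \<open>g\<close> groups of the output extend to an optimal solution; \<open>j\<close> jobs remain.\<close>

definition chain :: "(nat \<Rightarrow> nat) \<Rightarrow> (nat \<Rightarrow> nat) \<Rightarrow> nat \<Rightarrow> nat \<Rightarrow> bool" where
  "chain e ty g j \<longleftrightarrow> e 0 = 0 \<and> e g = n - j \<and>
     (\<forall>h\<in>{1..g}. e (h - 1) < e h \<and> e h \<le> n \<and> ty h \<in> {1..k} \<and>
        psum (n - e (h - 1)) - psum (n - e h) \<le> W (ty h)) \<and>
     (\<Sum>h\<in>{1..g}. c (ty h) * mx (n - e h) (n - e (h - 1))) + opt j \<le> opt n"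

lemma chain_0: "e 0 = 0 \<Longrightarrow> chain e ty 0 n"
  by (simp add: chain_def)

lemma chain_Suc:
  assumes "chain e ty g j" "i < j" "j \<le> n" "a \<in> {1..k}" "psum j - psum i \<le> W a"
    "opt i + c a * mx i j \<le> opt j"
  shows "chain (e(Suc g := n - i)) (ty(Suc g := a)) (Suc g) i"
proof -
  have ext: "{1..Suc g} = insert (Suc g) {1..g}" by auto
  have "(\<Sum>h\<in>{1..g}. c ((ty(Suc g := a)) h) *
      mx (n - (e(Suc g := n - i)) h) (n - (e(Suc g := n - i)) (h - 1))) =
    (\<Sum>h\<in>{1..g}. c (ty h) * mx (n - e h) (n - e (h - 1)))"
    by (intro sum.cong) auto
  then show ?thesis
    using assms unfolding chain_def ext by auto
qed

lemma chain_mono: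
  assumes "chain e ty g j"
  shows "h \<le> h' \<Longrightarrow> h' \<le> g \<Longrightarrow> e h \<le> e h'"
proof (induction h' rule: dec_induct)
  case (step m)
  then have "e (Suc m - 1) < e (Suc m)"
    using assms unfolding chain_def by (metis One_nat_def Suc_le_mono atLeastAtMost_iff le0)
  with step show ?case by simp
qed simp

text \<open>The ends \<open>e\<close> increase strictly from 0 to \<open>n\<close>, so the groups
  form a partition. Its cost is at most \<open>opt n\<close>, which bounds every solution from
  below.\<close>

lemma chain_optimal:
  assumes I: "represents I" and ch: "chain e ty g 0"
  defines "blk \<equiv> \<lambda>h. {e (h - 1)<..e h}"
  shows "\<exists>\<alpha>. (\<forall>h\<in>{1..g}. \<alpha> (blk h) = ty h) \<and> optimal_solution I (blk ` {1..g}) \<alpha>"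
proof -
  have e: "e 0 = 0" "e g = n" "\<And>h. h \<in> {1..g} \<Longrightarrow> e (h - 1) < e h \<and> e h \<le> n \<and> ty h \<in> {1..k} \<and>
        psum (n - e (h - 1)) - psum (n - e h) \<le> W (ty h)"
     "(\<Sum>h\<in>{1..g}. c (ty h) * mx (n - e h) (n - e (h - 1))) \<le> opt n"
    using ch by (auto simp: chain_def)
  have disj: "blk h \<inter> blk h' = {}" if "h < h'" "h \<in> {1..g}" "h' \<in> {1..g}" for h h'
    using chain_mono[OF ch, of h "h' - 1"] that by (force simp: blk_def)
  have ne: "blk h \<noteq> {}" if "h \<in> {1..g}" for h
    using e(3)[OF that] by (auto simp: blk_def)
  have inj: "inj_on blk {1..g}"
  proof (rule inj_onI)
    fix h h' assume "h \<in> {1..g}" "h' \<in> {1..g}" "blk h = blk h'"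
    then show "h = h'"
      using disj[of h h'] disj[of h' h] ne[of h] by (cases h h' rule: linorder_cases) auto
  qed
  \<comment> \<open>An assignment takes groups rather than their numbers as arguments; injectivity
    of \<open>blk\<close> recovers the number.\<close>
  define \<alpha> where "\<alpha> = (\<lambda>B. ty (inv_into {1..g} blk B))"
  have \<alpha>: "\<alpha> (blk h) = ty h" if "h \<in> {1..g}" for h
    unfolding \<alpha>_def using inv_into_f_f[OF inj that] by simp
  have cover: "\<Union> (blk ` {1..h}) = {1..e h}" if "h \<le> g" for h
    using that
  proof (induction h)
    case 0
    then show ?case using e(1) by simp
  next
    case (Suc h)
    have "{1..Suc h} = insert (Suc h) {1..h}" by auto
    with Suc e(3)[of "Suc h"] show ?case by (auto simp: blk_def)
  qed
  have seg: "blk h = {n - (n - e (h - 1))<..n - (n - e h)}" "n - e h < n - e (h - 1)" if "h \<in>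
      {1..g}" for h
    using e(3)[OF that] by (auto simp: blk_def)
  have "partition_on {1..n} (blk ` {1..g})"
  proof (rule partition_onI)
    show "\<Union> (blk ` {1..g}) = {1..n}" using cover[of g] e(2) by simp
    show "{} \<notin> blk ` {1..g}" using ne by (metis imageE)
  next
    fix B B' assume "B \<in> blk ` {1..g}" "B' \<in> blk ` {1..g}" "B \<noteq> B'"
    then obtain h h' where h: "h \<in> {1..g}" "h' \<in> {1..g}" "B = blk h" "B' = blk h'" "h \<noteq> h'"
      by (metis imageE)
    then show "disjnt B B'"
      using disj[of h h'] disj[of h' h] by (cases h h' rule: linorder_cases) (auto simp: disjnt_def)
  qed
  moreover have "\<exists>x y. blk h = {x..y}" for h
    by (rule exI[of _ "e (h - 1) + 1"], rule exI[of _ "e h"]) (auto simp: blk_def)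
  moreover have "\<alpha> (blk h) \<in> {1..k} \<and> (\<Sum>i\<in>blk h. weight I i) \<le> threshold I (\<alpha> (blk h))"
    if h: "h \<in> {1..g}" for h
    using e(3)[OF h] segment_weight[OF I, of "n - e h" "n - e (h - 1)"] seg[OF h] I
    unfolding \<alpha>[OF h] by (simp add: represents_def)
  moreover have nk: "njobs I = n" "ntypes I = k" using I by (auto simp: represents_def)
  ultimately have valid: "valid_solution I (blk ` {1..g}) \<alpha>"
    unfolding valid_solution_def ball_simps(9) by metis
  have "total_cost I (blk ` {1..g}) \<alpha> = (\<Sum>h\<in>{1..g}. coeff I (\<alpha> (blk h)) * Max (sval I ` blk h))"
    unfolding total_cost_def sum.reindex[OF inj] o_def ..
  also have "\<dots> = (\<Sum>h\<in>{1..g}. c (ty h) * mx (n - e h) (n - e (h - 1)))"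
  proof (rule sum.cong)
    fix h assume h: "h \<in> {1..g}"
    have "Max (sval I ` blk h) = mx (n - e h) (n - e (h - 1))"
      using segment_max[OF I seg(2)[OF h]] seg(1)[OF h] by simp
    then show "coeff I (\<alpha> (blk h)) * Max (sval I ` blk h) = c (ty h) * mx (n - e h) (n - e (h - 1))"
      using e(3)[OF h] I by (simp add: \<alpha>[OF h] represents_def)
  qed simp
  also have "\<dots> \<le> opt n" by (rule e(4))
  finally have cost: "total_cost I (blk ` {1..g}) \<alpha> \<le> opt n" .
  have "opt n \<le> total_cost I P \<beta>" if "valid_solution I P \<beta>" for P \<beta>
  proof -
    have "{n - n<..n} = {1..n}" by auto
    then show ?thesis
      using that by (intro opt_le_partition[OF I]) (simp_all add: valid_solution_def nk)
  qed
  with valid cost have "optimal_solution I (blk ` {1..g}) \<alpha>"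
    unfolding optimal_solution_def by force
  with \<alpha> show ?thesis by blast
qed

text \<open>Weights being nonnegative, the type that processes the group of a job can process this
  job alone. This justifies reporting infeasibility.\<close>

lemma valid_solution_feasible:
  assumes I: "represents I" and "valid_solution I P \<alpha>" "j \<in> {1..n}"
  shows "\<exists>a\<in>{1..k}. w j \<le> W a"
proof -
  let ?x = "n + 1 - j"
  have x: "?x \<in> {1..n}" using assms(3) by auto
  moreover have "{1..n} = \<Union>P"
    using assms(2) I by (auto simp: valid_solution_def represents_def dest!: partition_onD1)
  ultimately obtain B where B: "B \<in> P" "?x \<in> B" by blast
  have sub: "B \<subseteq> {1..n}"
    using B(1) assms(2) I by (auto simp: valid_solution_def represents_def partition_on_def)
  have "weight I ?x \<le> (\<Sum>i\<in>B. weight I i)"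
    using B(2) sub I w_nonneg by (intro member_le_sum) (auto simp: represents_def intro:
        finite_subset)
  moreover have "weight I ?x = w j"
    using I x assms(3) by (simp add: represents_def)
  moreover have "\<alpha> B \<in> {1..k}" "(\<Sum>i\<in>B. weight I i) \<le> W (\<alpha> B)"
    using assms(2) B(1) I by (auto simp: valid_solution_def represents_def)
  ultimately show ?thesis by force
qed

end

section \<open>Preprocessing\<close>

abbreviation NV :: "vname \<Rightarrow> nexp" where "NV x \<equiv> NGet x (NConst 0)"
abbreviation RV :: "vname \<Rightarrow> rexp" where "RV x \<equiv> RGet x (NConst 0)"
abbreviation NPut :: "vname \<Rightarrow> nexp \<Rightarrow> com" where "NPut x e \<equiv> NSet x (NConst 0) e"
abbreviation RPut :: "vname \<Rightarrow> rexp \<Rightarrow> com" where "RPut x e \<equiv> RSet x (NConst 0) e"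
abbreviation NInc :: "vname \<Rightarrow> com" where "NInc x \<equiv> NPut x (NPlus (NV x) (NConst 1))"

fun block :: "com list \<Rightarrow> com" where
  "block [] = Skip"
| "block [p] = p"
| "block (p # q # ps) = Seq p (block (q # ps))"

text \<open>With at least one type, a job can be processed alone iff its weight is at most
  \<open>wmax\<close>, so one comparison per job decides feasibility.\<close>

definition totals_prog :: com where
  "totals_prog = block [
     NPut ''a'' (NConst 0), RPut ''csum'' (RConst 0), RPut ''wmax'' (RConst 0),
     While (NLess (NV ''a'') (NV ''k'')) (block [
       NInc ''a'',
       RPut ''csum'' (RPlus (RV ''csum'') (RGet ''c'' (NV ''a''))),
       Cond (RLess (RV ''wmax'') (RGet ''w0'' (NV ''a'')))
         (RPut ''wmax'' (RGet ''w0'' (NV ''a''))) Skip])]"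

text \<open>Position \<open>j\<close> of \<open>S\<close> refers to job \<open>n + 1 - j\<close> of
  the input, and \<open>P\<close> sums the weights in this reversed order. \<open>ssum\<close> is
  the second factor of \<open>top_cost\<close>.\<close>

definition copy_prog :: com where
  "copy_prog = block [
     RSet ''P'' (NConst 0) (RConst 0), RPut ''ssum'' (RConst 0),
     NPut ''bad'' (NConst 0), NPut ''j'' (NConst 0),
     While (NLess (NV ''j'') (NV ''n'')) (block [
       NInc ''j'',
       NPut ''i'' (NMinus (NPlus (NV ''n'') (NConst 1)) (NV ''j'')),
       RSet ''S'' (NV ''j'') (RGet ''s'' (NV ''i'')),
       RSet ''P'' (NV ''j'')
         (RPlus (RGet ''P'' (NMinus (NV ''j'') (NConst 1))) (RGet ''w'' (NV ''i''))),
       RPut ''ssum'' (RPlus (RV ''ssum'') (RGet ''s'' (NV ''i''))),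
       Cond (RLess (RV ''wmax'') (RGet ''w'' (NV ''i''))) (NPut ''bad'' (NConst 1)) Skip])]"

text \<open>The array \<open>dep\<close> is only needed for the time bound: it holds the length of the chain of
  \<open>prev\<close>-links, which pays for the iterations of the inner loop.\<close>

definition prev_prog :: com where
  "prev_prog = block [
     NSet ''dep'' (NConst 0) (NConst 0), NPut ''j'' (NConst 0),
     While (NLess (NV ''j'') (NV ''n'')) (block [
       NPut ''p'' (NV ''j''),
       NInc ''j'',
       While (BAnd (NLess (NConst 0) (NV ''p''))
                   (BNot (RLess (RGet ''S'' (NV ''j'')) (RGet ''S'' (NV ''p'')))))
         (NPut ''p'' (NGet ''prev'' (NV ''p''))),
       NSet ''prev'' (NV ''j'') (NV ''p''),
       NSet ''dep'' (NV ''j'') (NPlus (NGet ''dep'' (NV ''p'')) (NConst 1))])]"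

section \<open>Correctness of the preprocessing\<close>

context jobs
begin

definition input :: "state \<Rightarrow> bool" where
  "input \<sigma> \<longleftrightarrow> nmem \<sigma> ''n'' 0 = n \<and> nmem \<sigma> ''k'' 0 = k \<and> rmem \<sigma> ''w0'' = W \<and> rmem \<sigma> ''c'' = c \<and>
     (\<forall>j\<in>{1..n}. rmem \<sigma> ''w'' (n + 1 - j) = w j \<and> rmem \<sigma> ''s'' (n + 1 - j) = s j)"

lemma input_frame:
  assumes "input \<sigma>" "frame p \<sigma> \<tau>" "nwrites p \<inter> {''n'', ''k''} = {}"
    "rwrites p \<inter> {''w0'', ''c'', ''w'', ''s''} = {}"
  shows "input \<tau>"
  using assms by (auto simp: input_def frame_def)

lemma input_rev:
  assumes "input \<sigma>" "j < n"
  shows "rmem \<sigma> ''w'' (n - j) = w (Suc j)" "rmem \<sigma> ''s'' (n - j) = s (Suc j)"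
proof -
  have "Suc j \<in> {1..n}" using assms(2) by simp
  with assms(1) show "rmem \<sigma> ''w'' (n - j) = w (Suc j)" "rmem \<sigma> ''s'' (n - j) = s (Suc j)"
    unfolding input_def by fastforce+
qed

text \<open>Quantifying over all \<open>x\<close> describes \<open>wmax\<close> as the maximum of 0
  and the thresholds, in a form that is easily updated by one more threshold.\<close>

lemma totals_prog_correct:
  assumes "input \<sigma>"
  shows "wp totals_prog (\<lambda>\<tau> u. rmem \<tau> ''csum'' 0 = sum c {1..k} \<and>
    (\<forall>x. rmem \<tau> ''wmax'' 0 < x \<longleftrightarrow> 0 < x \<and> (\<forall>a\<in>{1..k}. W a < x)) \<and> u \<le> t + 60 * (k + 1)) \<sigma> t"
  unfolding totals_prog_def block.simps wp_Seq wp_NSet wp_RSet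
proof (rule wp_While[where J = "\<lambda>\<tau> u. input \<tau> \<and> nmem \<tau> ''a'' 0 \<le> k \<and>
     rmem \<tau> ''csum'' 0 = sum c {1..nmem \<tau> ''a'' 0} \<and>
     (\<forall>x. rmem \<tau> ''wmax'' 0 < x \<longleftrightarrow> 0 < x \<and> (\<forall>a\<in>{1..nmem \<tau> ''a'' 0}. W a < x)) \<and>
     u \<le> t + 40 + 60 * nmem \<tau> ''a'' 0" and N = "t + 40 + 60 * k"], goal_cases)
  case 1
  then show ?case using assms by (simp add: input_def)
next
  case (2 \<tau> u)
  then show ?case by simp
next
  case (3 \<tau> u)
  then show ?case
    by (simp add: input_def) (auto simp: atLeastAtMostSuc_conv)
next
  case (4 \<tau> u)
  then show ?case by (auto simp: input_def)
qed


lemma copy_prog_correct: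
  assumes "input \<sigma>"
  shows "wp copy_prog (\<lambda>\<tau> u. (\<forall>i\<in>{1..n}. rmem \<tau> ''S'' i = s i) \<and>
     (\<forall>i\<le>n. rmem \<tau> ''P'' i = psum i) \<and> rmem \<tau> ''ssum'' 0 = sum s {1..n} \<and>
     (nmem \<tau> ''bad'' 0 = 0 \<longleftrightarrow> (\<forall>i\<in>{1..n}. w i \<le> rmem \<sigma> ''wmax'' 0)) \<and>
     u \<le> t + 80 * (n + 1)) \<sigma> t"
  unfolding copy_prog_def block.simps wp_Seq wp_NSet wp_RSet
proof (rule wp_While[where J = "\<lambda>\<tau> u. input \<tau> \<and> nmem \<tau> ''j'' 0 \<le> n \<and>
     rmem \<tau> ''wmax'' 0 = rmem \<sigma> ''wmax'' 0 \<and>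
     (\<forall>i\<in>{1..nmem \<tau> ''j'' 0}. rmem \<tau> ''S'' i = s i) \<and> (\<forall>i\<le>nmem \<tau> ''j'' 0. rmem \<tau> ''P'' i = psum i) \<and>
     rmem \<tau> ''ssum'' 0 = sum s {1..nmem \<tau> ''j'' 0} \<and>
     (nmem \<tau> ''bad'' 0 = 0 \<longleftrightarrow> (\<forall>i\<in>{1..nmem \<tau> ''j'' 0}. w i \<le> rmem \<sigma> ''wmax'' 0)) \<and>
     u \<le> t + 40 + 80 * nmem \<tau> ''j'' 0" and N = "t + 40 + 80 * n"], goal_cases)
  case 1
  then show ?case using assms by (simp add: input_def)
next
  case (2 \<tau> u)
  then show ?case by simp
next
  case (3 \<tau> u)
  define j where "j = nmem \<tau> ''j'' 0"
  have "rmem \<tau> ''w'' (n - j) = w (Suc j)" "rmem \<tau> ''s'' (n - j) = s (Suc j)"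
    using 3 input_rev[of \<tau> j] by (simp_all add: j_def input_def)
  with 3 show ?case
    by (simp add: input_def flip: j_def) (auto simp: atLeastAtMostSuc_conv le_Suc_eq psum_Suc not_le
      intro!: bexI[of _ "Suc j"])
next
  case (4 \<tau> u)
  then show ?case by (auto simp: input_def)
qed

lemma prev_prog_correct:
  assumes "input \<sigma>" "\<forall>i\<in>{1..n}. rmem \<sigma> ''S'' i = s i"
  shows "wp prev_prog (\<lambda>\<tau> u. (\<forall>i\<in>{1..n}. prev_greater i (nmem \<tau> ''prev'' i)) \<and>
     u \<le> t + 90 * (n + 1)) \<sigma> t"
  unfolding prev_prog_def block.simps wp_Seq wp_NSet wp_RSet
\<comment> \<open>The potential is \<open>dep\<close> of the last position: following a
  \<open>prev\<close> link lowers it by one and releases 30 units, more than an inner iteration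
  costs. A new position adds only one to the depth reached.\<close>
proof (rule wp_While[where J = "\<lambda>\<tau> u. input \<tau> \<and> (\<forall>i\<in>{1..n}. rmem \<tau> ''S'' i = s i) \<and>
     nmem \<tau> ''j'' 0 \<le> n \<and> nmem \<tau> ''dep'' 0 = 0 \<and>
     (\<forall>i\<in>{1..nmem \<tau> ''j'' 0}. prev_greater i (nmem \<tau> ''prev'' i) \<and>
        nmem \<tau> ''dep'' i = nmem \<tau> ''dep'' (nmem \<tau> ''prev'' i) + 1) \<and>
     u + 30 * nmem \<tau> ''dep'' (nmem \<tau> ''j'' 0) \<le> t + 30 + 90 * nmem \<tau> ''j'' 0"
   and N = "t + 40 + 90 * n"], goal_cases)
  case 1
  then show ?case using assms by (simp add: input_def)
next
  case (2 \<tau> u)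
  then show ?case by simp
next
  case (3 \<sigma>' v)
  note outer = 3
  define j where "j = nmem \<sigma>' ''j'' 0"
  have j: "j < n" using 3 by (simp add: j_def input_def)
  show ?case
    unfolding block.simps wp_Seq wp_NSet wp_RSet
  proof (rule wp_While[where J = "\<lambda>\<tau> u. input \<tau> \<and> (\<forall>i\<in>{1..n}. rmem \<tau> ''S'' i = s i) \<and>
     nmem \<tau> ''j'' 0 = Suc j \<and> nmem \<tau> ''dep'' = nmem \<sigma>' ''dep'' \<and>
         nmem \<tau> ''prev'' = nmem \<sigma>' ''prev'' \<and>
     nmem \<tau> ''p'' 0 \<le> j \<and> (\<forall>q. nmem \<tau> ''p'' 0 < q \<and> q \<le> j \<longrightarrow> s q \<le> s (Suc j)) \<and>
     u + 30 * nmem \<sigma>' ''dep'' (nmem \<tau> ''p'' 0) \<le> t + 60 + 90 * j" and N = "t + 60 + 90 * n"],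
         goal_cases)
    case 1
    then show ?case using 3 j by (simp add: input_def flip: j_def)
  next
    case (2 \<tau> u)
    then show ?case using j by simp
  next
    case (3 \<tau> u)
    define p where "p = nmem \<tau> ''p'' 0"
    have p: "p \<in> {1..j}" "s p \<le> s (Suc j)"
      using 3 j by (auto simp: p_def)
    then have "prev_greater p (nmem \<sigma>' ''prev'' p)" "nmem \<sigma>' ''dep'' p = nmem \<sigma>' ''dep'' (nmem \<sigma>'
        ''prev'' p) + 1"
      using outer(1) by (simp_all add: j_def)
    \<comment> \<open>The jump from \<open>p\<close> along its \<open>prev\<close> link skips only
      values at most \<open>s p\<close>, hence at most \<open>s (Suc j)\<close>.\<close>
    moreover have "s q \<le> s (Suc j)" if "nmem \<sigma>' ''prev'' p < q" "q \<le> j" for q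
      using that p 3(1) \<open>prev_greater p _\<close>
      by (cases q p rule: linorder_cases) (auto simp: prev_greater_def p_def intro: order_trans)
    ultimately show ?case using 3 p
      by (auto simp: input_def prev_greater_def simp flip: p_def)
  next
    case (4 \<tau> u)
    have "nmem \<tau> ''p'' 0 = 0 \<or> s (Suc j) < s (nmem \<tau> ''p'' 0)"
      using 4 j by (cases "nmem \<tau> ''p'' 0 = 0") simp_all
    with 4 have "prev_greater (Suc j) (nmem \<tau> ''p'' 0)"
      by (simp add: prev_greater_def)
    moreover define pv where "pv = (nmem \<sigma>' ''prev'')(Suc j := nmem \<tau> ''p'' 0)"
    moreover define dep where "dep = (nmem \<sigma>' ''dep'')(Suc j := Suc (nmem \<sigma>' ''dep'' (nmem \<tau> ''p''
        0)))"
    ultimately have "prev_greater i (pv i) \<and> dep i = Suc (dep (pv i))" if "i \<in> {1..Suc j}" for i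
    proof (cases "i = Suc j")
      case True
      with \<open>prev_greater (Suc j) (nmem \<tau> ''p'' 0)\<close> show ?thesis
        by (auto simp: pv_def dep_def prev_greater_def)
    next
      case False
      with that have "i \<in> {1..nmem \<sigma>' ''j'' 0}" by (simp add: j_def)
      with outer(1) have i: "prev_greater i (nmem \<sigma>' ''prev'' i)"
          "nmem \<sigma>' ''dep'' i = nmem \<sigma>' ''dep'' (nmem \<sigma>' ''prev'' i) + 1"
        by blast+
      then have "nmem \<sigma>' ''prev'' i < Suc j"
        using that by (simp add: prev_greater_def)
      with i False 4(1) show ?thesis by (simp add: pv_def dep_def)
    qed
    moreover have "dep 0 = 0" "dep (Suc j) = Suc (nmem \<sigma>' ''dep'' (nmem \<tau> ''p'' 0))"
      using outer(1) 4(1) by (simp_all add: dep_def)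
    ultimately show ?case
      using 4(1) j by (simp add: input_def fun_upd_same fun_upd_other del: fun_upd_apply
        flip: pv_def dep_def)
  qed
next
  case (4 \<tau> u)
  then show ?case by (auto simp: input_def)
qed

end

section \<open>Starting a phase\<close>

text \<open>A phase for type \<open>a\<close> that starts at \<open>j\<close>: \<open>extend_prog\<close> finds its last position \<open>e\<close> and sets
  \<open>B i = M j i\<close>; \<open>fill_prog\<close> runs \<open>i\<close> down from \<open>e\<close> to \<open>j\<close> and maintains the window start \<open>lo\<close>, the end
  \<open>hi\<close> of the candidates \<open>x\<close> in the window with \<open>A x = M x j \<ge> B i\<close>, and their minimum \<open>cur\<close>. Row \<open>a\<close>
  of the table \<open>L\<close> starts at address \<open>off = a * (n + 1)\<close>. Windows do not extend to the left of \<open>old\<close>,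
  the start of the previous phase.\<close>

definition extend_prog :: com where
  "extend_prog = block [
     NPut ''e'' (NV ''j''), RSet ''B'' (NV ''j'') (RConst 0),
     While (BAnd (NLess (NV ''e'') (NV ''n''))
       (BNot (RLess (RGet ''w0'' (NV ''a''))
         (RMinus (RGet ''P'' (NPlus (NV ''e'') (NConst 1)))
                 (RGet ''P'' (NMinus (NV ''j'') (NConst 1))))))) (block [
       NPut ''i'' (NV ''e''),
       NInc ''e'',
       Cond (RLess (RGet ''B'' (NV ''i'')) (RGet ''S'' (NV ''e'')))
         (RSet ''B'' (NV ''e'') (RGet ''S'' (NV ''e'')))
         (RSet ''B'' (NV ''e'') (RGet ''B'' (NV ''i'')))])]"

definition lower_prog :: com where
  "lower_prog =
     While (BAnd (NLess (NV ''old'') (NV ''lo''))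
       (BNot (RLess (RGet ''w0'' (NV ''a''))
         (RMinus (RGet ''P'' (NV ''i'')) (RGet ''P'' (NMinus (NV ''lo'') (NConst 1))))))) (block [
       NPut ''p'' (NV ''lo''),
       NPut ''lo'' (NMinus (NV ''lo'') (NConst 1)),
       Cond (RLess (RGet ''A'' (NV ''p'')) (RGet ''S'' (NV ''p'')))
         (RSet ''A'' (NV ''lo'') (RGet ''S'' (NV ''p'')))
         (RSet ''A'' (NV ''lo'') (RGet ''A'' (NV ''p''))),
       Cond (RLess (RGet ''A'' (NV ''lo'')) (RGet ''B'' (NV ''i'')))
         (NPut ''hi'' (NV ''lo''))
         (block [
            RPut ''x'' (RPlus (RGet ''D'' (NV ''lo''))
              (RTimes (RGet ''c'' (NV ''a'')) (RGet ''A'' (NV ''lo'')))),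
            Cond (RLess (RV ''x'') (RV ''cur'')) (RPut ''cur'' (RV ''x'')) Skip])])"

definition raise_prog :: com where
  "raise_prog =
     While (BAnd (NLess (NV ''hi'') (NV ''j''))
       (BNot (RLess (RGet ''A'' (NV ''hi'')) (RGet ''B'' (NV ''i''))))) (block [
       RPut ''x'' (RPlus (RGet ''D'' (NV ''hi''))
         (RTimes (RGet ''c'' (NV ''a'')) (RGet ''A'' (NV ''hi'')))),
       Cond (RLess (RV ''x'') (RV ''cur'')) (RPut ''cur'' (RV ''x'')) Skip,
       NInc ''hi''])"

definition fill_prog :: com where
  "fill_prog = block [
     NPut ''lo'' (NV ''j''), NPut ''hi'' (NV ''j''), RPut ''cur'' (RV ''top''),
     RSet ''A'' (NV ''j'') (RConst 0), NPut ''i'' (NV ''e''),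
     While (BNot (NLess (NV ''i'') (NV ''j''))) (block [
       lower_prog,
       raise_prog,
       RPut ''V'' (RV ''cur''),
       Cond (NLess (NV ''hi'') (NV ''j''))
         (block [
            RPut ''x'' (RPlus (RGet ''D'' (NV ''hi''))
              (RTimes (RGet ''c'' (NV ''a'')) (RGet ''B'' (NV ''i'')))),
            Cond (RLess (RV ''x'') (RV ''V'')) (RPut ''V'' (RV ''x'')) Skip])
         Skip,
       RSet ''L'' (NPlus (NV ''off'') (NV ''i'')) (RV ''V''),
       NPut ''i'' (NMinus (NV ''i'') (NConst 1))])]"

section \<open>Correctness of the start of a phase\<close>

context jobs
begin

definition data :: "state \<Rightarrow> bool" where
  "data \<sigma> \<longleftrightarrow> input \<sigma> \<and> (\<forall>j\<in>{1..n}. rmem \<sigma> ''S'' j = s j) \<and> (\<forall>j\<le>n. rmem \<sigma> ''P'' j = psum j) \<and>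
     (\<forall>j\<in>{1..n}. prev_greater j (nmem \<sigma> ''prev'' j)) \<and> rmem \<sigma> ''top'' 0 = top_cost"

lemma data_cong:
  assumes "\<And>x. x \<in> {''n'', ''k'', ''prev''} \<Longrightarrow> nmem \<tau> x = nmem \<sigma> x"
    "\<And>x. x \<in> {''w0'', ''c'', ''w'', ''s'', ''S'', ''P'', ''top''} \<Longrightarrow> rmem \<tau> x = rmem \<sigma> x"
  shows "data \<tau> \<longleftrightarrow> data \<sigma>"
  by (simp add: data_def input_def assms)

lemma data_nupd [simp]:
  "x \<notin> {''n'', ''k'', ''prev''} \<Longrightarrow> data (nupd x i m \<sigma>) \<longleftrightarrow> data \<sigma>"
  by (rule data_cong) (metis fun_upd_other nmem_nupd, simp)

lemma data_rupd [simp]: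
  "x \<notin> {''w0'', ''c'', ''w'', ''s'', ''S'', ''P'', ''top''} \<Longrightarrow> data (rupd x i r \<sigma>) \<longleftrightarrow> data \<sigma>"
  by (rule data_cong) (simp, metis fun_upd_other rmem_rupd)

lemma data_frame:
  assumes "data \<sigma>" "frame p \<sigma> \<tau>" "nwrites p \<inter> {''n'', ''k'', ''prev''} = {}"
    "rwrites p \<inter> {''w0'', ''c'', ''w'', ''s'', ''S'', ''P'', ''top''} = {}"
  shows "data \<tau>"
  using assms(1) by (rule data_cong[THEN iffD2, rotated 2])
    (use assms(2-4) in \<open>unfold frame_def, blast\<close>)+

lemma dataD:
  assumes "data \<sigma>"
  shows "nmem \<sigma> ''n'' 0 = n" "nmem \<sigma> ''k'' 0 = k" "rmem \<sigma> ''w0'' a = W a" "rmem \<sigma> ''c'' a = c a"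
    "1 \<le> j \<Longrightarrow> j \<le> n \<Longrightarrow> rmem \<sigma> ''S'' j = s j" "j \<le> n \<Longrightarrow> rmem \<sigma> ''P'' j = psum j"
    "1 \<le> j \<Longrightarrow> j \<le> n \<Longrightarrow> prev_greater j (nmem \<sigma> ''prev'' j)" "rmem \<sigma> ''top'' 0 = top_cost"
  using assms by (auto simp: data_def input_def)

text \<open>The phase lasts as long as candidate \<open>j - 1\<close> stays light enough. Maximality
  of \<open>e\<close> ensures that later windows do not reach to the left of
  \<open>j\<close>.\<close>

lemma extend_prog_correct:
  assumes "data \<sigma>" "nmem \<sigma> ''j'' 0 = j" "nmem \<sigma> ''a'' 0 = a" "1 \<le> j" "j \<le> n"
  shows "wp extend_prog (\<lambda>\<tau> u. \<exists>e. nmem \<tau> ''e'' 0 = e \<and> j \<le> e \<and> e \<le> n \<and>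
     (\<forall>i\<in>{j..e}. rmem \<tau> ''B'' i = mx j i) \<and> (j < e \<longrightarrow> psum e - psum (j - 1) \<le> W a) \<and>
     (e < n \<longrightarrow> W a < psum (e + 1) - psum (j - 1)) \<and> u + 60 * j \<le> t + 60 * e + 60) \<sigma> t"
  unfolding extend_prog_def block.simps wp_Seq wp_NSet wp_RSet
proof (rule wp_While[where J = "\<lambda>\<tau> u. data \<tau> \<and> nmem \<tau> ''j'' 0 = j \<and> nmem \<tau> ''a'' 0 = a \<and>
     j \<le> nmem \<tau> ''e'' 0 \<and> nmem \<tau> ''e'' 0 \<le> n \<and>
     (\<forall>i\<in>{j..nmem \<tau> ''e'' 0}. rmem \<tau> ''B'' i = mx j i) \<and>
     (j < nmem \<tau> ''e'' 0 \<longrightarrow> psum (nmem \<tau> ''e'' 0) - psum (j - 1) \<le> W a) \<and>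
     u + 60 * j \<le> t + 60 * nmem \<tau> ''e'' 0 + 20"
   and N = "t + 60 * n + 20"], goal_cases)
  case 1
  then show ?case using assms by simp
next
  case (2 \<tau> u)
  then show ?case by simp
next
  case (3 \<tau> u)
  define e where "e = nmem \<tau> ''e'' 0"
  from 3 assms show ?case
    by (auto simp: dataD mx_Suc le_Suc_eq simp flip: e_def)
next
  case (4 \<tau> u)
  then have "rmem \<tau> ''P'' (j - 1) = psum (j - 1)"
    using assms by (intro dataD) auto
  with 4 assms show ?case
    by (simp add: dataD)
qed

text \<open>The candidates from \<open>lo\<close> on are light enough, and those before
  \<open>hi\<close> dominate \<open>mx j i\<close>. Both survive decreasing \<open>i\<close>; that
  \<open>lo\<close> and \<open>hi\<close> cannot move further is added by the inner loops.\<close>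

definition window :: "state \<Rightarrow> nat \<Rightarrow> nat \<Rightarrow> nat \<Rightarrow> nat \<Rightarrow> bool" where
  "window \<sigma> a j i old \<longleftrightarrow> (let lo = nmem \<sigma> ''lo'' 0; hi = nmem \<sigma> ''hi'' 0 in
     old \<le> lo \<and> lo \<le> hi \<and> hi \<le> j \<and>
     (\<forall>x\<in>{lo..j}. rmem \<sigma> ''A'' x = mx x j) \<and>
     rmem \<sigma> ''cur'' 0 = cmin (\<lambda>x. opt x + c a * mx x j) {lo..<hi} \<and>
     (\<forall>x\<in>{lo..<hi}. mx j i \<le> mx x j) \<and>
     (\<forall>x\<in>{lo..<j}. psum i - psum x \<le> W a))"

definition fill_inv :: "state \<Rightarrow> nat \<Rightarrow> nat \<Rightarrow> nat \<Rightarrow> nat \<Rightarrow> bool" where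
  "fill_inv \<sigma> a j i old \<longleftrightarrow> data \<sigma> \<and> nmem \<sigma> ''j'' 0 = j \<and> nmem \<sigma> ''a'' 0 = a \<and> nmem \<sigma> ''i'' 0 = i \<and>
     nmem \<sigma> ''old'' 0 = old \<and> rmem \<sigma> ''B'' i = mx j i \<and> (\<forall>x<j. rmem \<sigma> ''D'' x = opt x)"

text \<open>The potential \<open>180 * lo - 90 * hi\<close> pays for the loop: an iteration lowers
  \<open>lo\<close> by one and \<open>hi\<close> by at most one, which leaves at least 90
  units.\<close>

lemma lower_prog_correct:
  assumes "fill_inv \<sigma> a j i old" "window \<sigma> a j i old" "j \<le> i" "i \<le> n"
  shows "wp lower_prog (\<lambda>\<tau> u. fill_inv \<tau> a j i old \<and> window \<tau> a j i old \<and>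
     (nmem \<tau> ''lo'' 0 = old \<or> W a < psum i - psum (nmem \<tau> ''lo'' 0 - 1)) \<and>
     u + 180 * nmem \<tau> ''lo'' 0 + 90 * nmem \<sigma> ''hi'' 0 \<le> t + 180 * nmem \<sigma> ''lo'' 0 + 90 * nmem \<tau>
         ''hi'' 0 + 30) \<sigma> t"
  unfolding lower_prog_def
proof (rule wp_While[where J = "\<lambda>\<tau> u. fill_inv \<tau> a j i old \<and> window \<tau> a j i old \<and> 
     u + 180 * nmem \<tau> ''lo'' 0 + 90 * nmem \<sigma> ''hi'' 0 \<le> t + 180 * nmem \<sigma> ''lo'' 0 + 90 * nmem \<tau>
         ''hi'' 0"
   and N = "t + 180 * nmem \<sigma> ''lo'' 0 + 90 * j"], goal_cases)
  case 1
  then show ?case using assms by simp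
next
  case (2 \<tau> u)
  then show ?case by (simp add: window_def Let_def)
next
  case (3 \<tau> u)
  define lo where "lo = nmem \<tau> ''lo'' 0 - 1"
  define hi where "hi = nmem \<tau> ''hi'' 0"
  define cur where "cur = rmem \<tau> ''cur'' 0"
  have inv: "data \<tau>" "nmem \<tau> ''j'' 0 = j" "nmem \<tau> ''a'' 0 = a" "nmem \<tau> ''i'' 0 = i"
     "nmem \<tau> ''old'' 0 = old" "rmem \<tau> ''B'' i = mx j i" "\<forall>x<j. rmem \<tau> ''D'' x = opt x"
    using 3(1) by (simp_all add: fill_inv_def)
  have lo: "nmem \<tau> ''lo'' 0 = Suc lo" "old \<le> lo"
    using 3(2) inv by (auto simp: lo_def)
  have win: "Suc lo \<le> hi" "hi \<le> j" "\<forall>x\<in>{Suc lo..j}. rmem \<tau> ''A'' x = mx x j"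
     "cur = cmin (\<lambda>x. opt x + c a * mx x j) {Suc lo..<hi}"
     "\<forall>x\<in>{Suc lo..<hi}. mx j i \<le> mx x j" "\<forall>x\<in>{Suc lo..<j}. psum i - psum x \<le> W a"
    using 3(1) lo by (simp_all add: window_def Let_def hi_def cur_def)
  have "lo < j" using win by simp
  have val: "rmem \<tau> ''P'' i = psum i" "rmem \<tau> ''P'' lo = psum lo" "rmem \<tau> ''S'' (Suc lo) = s (Suc
      lo)"
     "rmem \<tau> ''A'' (Suc lo) = mx (Suc lo) j"
    using inv(1) win \<open>lo < j\<close> assms(3,4) by (auto simp: dataD)
  have ok: "psum i - psum lo \<le> W a"
    using 3(2) inv lo val by (simp add: dataD)
  have step: "mx lo j = max (mx (Suc lo) j) (s (Suc lo))"
    using \<open>lo < j\<close> by (rule mx_step)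
  have ok': "\<forall>x\<in>{lo..<j}. psum i - psum x \<le> W a"
    using ok win(6) by (metis Suc_leI atLeastLessThan_iff le_neq_implies_less)
  have A: "\<forall>x\<in>{lo..j}. ((rmem \<tau> ''A'')(lo := mx lo j)) x = mx x j"
    using win(3) by auto
  have time: "u + 180 * Suc lo + 90 * nmem \<sigma> ''hi'' 0 \<le> t + 180 * nmem \<sigma> ''lo'' 0 + 90 * hi"
    using 3(1) lo by (simp add: hi_def)
  show ?case
  proof (cases "mx lo j < mx j i")
    case True
    \<comment> \<open>\<open>mx x j\<close> does not increase with \<open>x\<close>, so no candidate
      to the right of \<open>lo\<close> dominates either. The old range was empty and
      \<open>cur\<close> is the cap; moving \<open>hi\<close> to \<open>lo\<close> keeps it
      so.\<close>
    have "hi = Suc lo"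
    proof (rule ccontr)
      assume "hi \<noteq> Suc lo"
      with win have "mx j i \<le> mx (Suc lo) j" by simp
      with True step show False by simp
    qed
    then show ?thesis
      using True A ok' win(4) time \<open>lo < j\<close> lo(2)
      by (cases "mx (Suc lo) j < s (Suc lo)")
       (simp_all add: fill_inv_def window_def Let_def dataD inv lo val step fun_upd_same
           fun_upd_other del: fun_upd_apply flip: hi_def cur_def)
  next
    case False
    have "{lo..<hi} = insert lo {Suc lo..<hi}" using win(1) by auto
    then have "cmin (\<lambda>x. opt x + c a * mx x j) {lo..<hi} = min (opt lo + c a * mx lo j) cur"
      by (simp add: cmin_insert win(4))
    moreover have "\<forall>x\<in>{lo..<hi}. mx j i \<le> mx x j"
      using win(5) False by (metis Suc_leI atLeastLessThan_iff le_neq_implies_less not_less)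
    ultimately show ?thesis
      using False A ok' win(1,2) time \<open>lo < j\<close> lo(2)
      by (cases "mx (Suc lo) j < s (Suc lo)"; cases "opt lo + c a * mx lo j < cur")
       (simp_all add: fill_inv_def window_def Let_def dataD inv lo val step fun_upd_same
           fun_upd_other del: fun_upd_apply flip: hi_def cur_def)
  qed
next
  case (4 \<tau> u)
  with assms show ?case
    by (auto simp: dataD fill_inv_def window_def Let_def)
qed

end

context jobs
begin

lemma window_nupd [simp]:
  "x \<notin> {''lo'', ''hi''} \<Longrightarrow> window (nupd x q m \<sigma>) a j i old \<longleftrightarrow> window \<sigma> a j i old"
  by (auto simp: window_def)

lemma window_rupd [simp]:
  "x \<notin> {''A'', ''cur''} \<Longrightarrow> window (rupd x q m \<sigma>) a j i old \<longleftrightarrow> window \<sigma> a j i old"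
  by (auto simp: window_def)

text \<open>Each iteration is paid for by raising \<open>hi\<close>, which \<open>lower_prog\<close>
  lowers at most once per step of \<open>lo\<close>; hence the total is linear.\<close>

lemma raise_prog_correct:
  assumes "fill_inv \<sigma> a j i old" "window \<sigma> a j i old"
  shows "wp raise_prog (\<lambda>\<tau> u. fill_inv \<tau> a j i old \<and> window \<tau> a j i old \<and>
     nmem \<tau> ''lo'' 0 = nmem \<sigma> ''lo'' 0 \<and>
     (nmem \<tau> ''hi'' 0 < j \<longrightarrow> mx (nmem \<tau> ''hi'' 0) j < mx j i) \<and>
     u + 90 * nmem \<sigma> ''hi'' 0 \<le> t + 90 * nmem \<tau> ''hi'' 0 + 30) \<sigma> t"
  unfolding raise_prog_def
proof (rule wp_While[where J = "\<lambda>\<tau> u. fill_inv \<tau> a j i old \<and> window \<tau> a j i old \<and>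
     nmem \<tau> ''lo'' 0 = nmem \<sigma> ''lo'' 0 \<and>
     u + 90 * nmem \<sigma> ''hi'' 0 \<le> t + 90 * nmem \<tau> ''hi'' 0"
   and N = "t + 90 * j"], goal_cases)
  case 1
  then show ?case using assms by simp
next
  case (2 \<tau> u)
  then show ?case by (simp add: window_def Let_def)
next
  case (3 \<tau> u)
  define lo where "lo = nmem \<tau> ''lo'' 0"
  define hi where "hi = nmem \<tau> ''hi'' 0"
  define cur where "cur = rmem \<tau> ''cur'' 0"
  have inv: "data \<tau>" "nmem \<tau> ''j'' 0 = j" "nmem \<tau> ''a'' 0 = a" "nmem \<tau> ''i'' 0 = i"
     "nmem \<tau> ''old'' 0 = old" "rmem \<tau> ''B'' i = mx j i" "\<forall>x<j. rmem \<tau> ''D'' x = opt x"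
    using 3(1) by (simp_all add: fill_inv_def)
  have win: "old \<le> lo" "lo \<le> hi" "hi \<le> j" "\<forall>x\<in>{lo..j}. rmem \<tau> ''A'' x = mx x j"
     "cur = cmin (\<lambda>x. opt x + c a * mx x j) {lo..<hi}"
     "\<forall>x\<in>{lo..<hi}. mx j i \<le> mx x j" "\<forall>x\<in>{lo..<j}. psum i - psum x \<le> W a"
    using 3(1) by (simp_all add: window_def Let_def hi_def cur_def lo_def)
  have "hi < j" "mx j i \<le> mx hi j"
    using 3(2) inv win(2,4) by (auto simp flip: hi_def)
  have time: "lo = nmem \<sigma> ''lo'' 0" "u + 90 * nmem \<sigma> ''hi'' 0 \<le> t + 90 * hi"
    using 3(1) by (simp_all add: hi_def lo_def)
  have "cmin (\<lambda>x. opt x + c a * mx x j) {lo..<Suc hi} = min (opt hi + c a * mx hi j) cur"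
    using win(2) by (simp add: atLeastLessThanSuc cmin_insert win(5))
  moreover have "\<forall>x\<in>{lo..<Suc hi}. mx j i \<le> mx x j"
    using win(6) \<open>mx j i \<le> mx hi j\<close> by (auto simp: less_Suc_eq)
  ultimately show ?case
    using win(1-4,7) \<open>hi < j\<close> time(2)
    by (cases "opt hi + c a * mx hi j < cur")
      (simp_all add: fill_inv_def window_def Let_def dataD inv flip: time(1) hi_def cur_def lo_def)
next
  case (4 \<tau> u)
  then have "nmem \<tau> ''hi'' 0 < j \<longrightarrow> mx (nmem \<tau> ''hi'' 0) j < mx j i"
    by (auto simp: fill_inv_def window_def Let_def)
  with 4(1) show ?case by simp
qed

end

context feasible_jobs
begin

text \<open>By the last assumption no window of this phase reaches to the left of
  \<open>old\<close>. The time is linear in the range \<open>j - old\<close> of \<open>lo\<close>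
  and the length of the phase, so it telescopes over phases.\<close>

lemma fill_prog_correct:
  assumes "data \<sigma>" "nmem \<sigma> ''j'' 0 = j" "nmem \<sigma> ''a'' 0 = a" "nmem \<sigma> ''e'' 0 = e"
    "nmem \<sigma> ''old'' 0 = old" "nmem \<sigma> ''off'' 0 = off"
    "\<forall>i\<in>{j..e}. rmem \<sigma> ''B'' i = mx j i" "\<forall>x<j. rmem \<sigma> ''D'' x = opt x"
    "a \<in> {1..k}" "1 \<le> j" "j \<le> e" "e \<le> n" "old \<le> j" "old = 0 \<or> W a < psum j - psum (old - 1)"
  shows "wp fill_prog (\<lambda>\<tau> u. (\<forall>i\<in>{j..e}. rmem \<tau> ''L'' (off + i) = left_min a j i) \<and>
     (\<forall>q. q \<notin> {off..off + n} \<longrightarrow> rmem \<tau> ''L'' q = rmem \<sigma> ''L'' q) \<and>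
     u + 180 * old + 200 * j \<le> t + 180 * j + 200 * e + 300) \<sigma> t"
  unfolding fill_prog_def block.simps wp_Seq wp_NSet wp_RSet
\<comment> \<open>The loop ends with \<open>i = j - 1\<close>, hence the bound
  \<open>j <= i + 1\<close>; \<open>1 <= j\<close> keeps the truncated subtraction exact.\<close>
proof (rule wp_While[where J = "\<lambda>\<tau> u. data \<tau> \<and> nmem \<tau> ''j'' 0 = j \<and> nmem \<tau> ''a'' 0 = a \<and>
     nmem \<tau> ''old'' 0 = old \<and> nmem \<tau> ''off'' 0 = off \<and>
     (\<forall>i\<in>{j..e}. rmem \<tau> ''B'' i = mx j i) \<and> (\<forall>x<j. rmem \<tau> ''D'' x = opt x) \<and>
     j \<le> nmem \<tau> ''i'' 0 + 1 \<and> nmem \<tau> ''i'' 0 \<le> e \<and> window \<tau> a j (nmem \<tau> ''i'' 0) old \<and>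
     (\<forall>i\<in>{j..e}. nmem \<tau> ''i'' 0 < i \<longrightarrow> rmem \<tau> ''L'' (off + i) = left_min a j i) \<and>
     (\<forall>q. q \<notin> {off..off + n} \<longrightarrow> rmem \<tau> ''L'' q = rmem \<sigma> ''L'' q) \<and>
     u + 180 * nmem \<tau> ''lo'' 0 + 200 * nmem \<tau> ''i'' 0 \<le>
       t + 90 * j + 90 * nmem \<tau> ''hi'' 0 + 200 * e + 60"
   and N = "t + 180 * j + 200 * e + 60"], goal_cases)
  case 1
  show ?case using assms by (simp add: window_def Let_def dataD)
next
  case (2 \<tau> u)
  then show ?case by (simp add: window_def Let_def)
next
  case (3 \<tau> u)
  define i where "i = nmem \<tau> ''i'' 0"
  have i: "j \<le> i" "i \<le> e" using 3 by (auto simp: i_def)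
  have pre: "fill_inv \<tau> a j i old" "window \<tau> a j i old"
    using 3(1) i by (simp_all add: fill_inv_def i_def)
  have out: "nmem \<tau> ''off'' 0 = off" "\<forall>i\<in>{j..e}. rmem \<tau> ''B'' i = mx j i"
     "\<forall>q\<in>{j..e}. i < q \<longrightarrow> rmem \<tau> ''L'' (off + q) = left_min a j q"
     "\<forall>q. q \<notin> {off..off + n} \<longrightarrow> rmem \<tau> ''L'' q = rmem \<sigma> ''L'' q"
     "u + 180 * nmem \<tau> ''lo'' 0 + 200 * i \<le>
       t + 90 * j + 90 * nmem \<tau> ''hi'' 0 + 200 * e + 60"
    using 3(1) by (simp_all add: i_def)
  show ?case
    unfolding block.simps wp_Seq
  proof (rule wp_conseq[OF lower_prog_correct[OF pre]], goal_cases)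
    case 1 show ?case using i by simp
  next
    case 2 show ?case using i assms by simp
  next
    case (3 \<tau>1 u1)
    note low = 3
    have fr1: "nmem \<tau>1 ''off'' = nmem \<tau> ''off''" "rmem \<tau>1 ''B'' = rmem \<tau> ''B''" "rmem \<tau>1 ''L'' =
        rmem \<tau> ''L''"
      using 3(2) by (simp_all add: frame_def lower_prog_def)
    show ?case
    proof (rule wp_conseq[OF raise_prog_correct[of _ a j i old]], goal_cases)
      case 1 show ?case using low(1) by blast
    next
      case 2 show ?case using low(1) by blast
    next
      case (3 \<tau>2 u2)
      define lo where "lo = nmem \<tau>2 ''lo'' 0"
      define hi where "hi = nmem \<tau>2 ''hi'' 0"
      define cur where "cur = rmem \<tau>2 ''cur'' 0"
      have fr2: "nmem \<tau>2 ''off'' = nmem \<tau>1 ''off''" "rmem \<tau>2 ''B'' = rmem \<tau>1 ''B''" "rmem \<tau>2 ''L''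
          = rmem \<tau>1 ''L''"
        using 3(2) by (simp_all add: frame_def raise_prog_def)
      have st: "nmem \<tau>2 ''off'' 0 = off" "\<forall>q\<in>{j..e}. rmem \<tau>2 ''B'' q = mx j q"
         "\<forall>q\<in>{j..e}. i < q \<longrightarrow> rmem \<tau>2 ''L'' (off + q) = left_min a j q"
         "\<forall>q. q \<notin> {off..off + n} \<longrightarrow> rmem \<tau>2 ''L'' q = rmem \<sigma> ''L'' q"
        using out(1-4) by (simp_all add: fr1 fr2)
      have inv: "data \<tau>2" "nmem \<tau>2 ''j'' 0 = j" "nmem \<tau>2 ''a'' 0 = a" "nmem \<tau>2 ''i'' 0 = i"
         "nmem \<tau>2 ''old'' 0 = old" "rmem \<tau>2 ''B'' i = mx j i" "\<forall>x<j. rmem \<tau>2 ''D'' x = opt x"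
        using 3(1) by (simp_all add: fill_inv_def)
      have win: "old \<le> lo" "lo \<le> hi" "hi \<le> j" "\<forall>x\<in>{lo..j}. rmem \<tau>2 ''A'' x = mx x j"
         "cur = cmin (\<lambda>x. opt x + c a * mx x j) {lo..<hi}"
         "\<forall>x\<in>{lo..<hi}. mx j i \<le> mx x j" "\<forall>x\<in>{lo..<j}. psum i - psum x \<le> W a"
        using 3(1) by (simp_all add: window_def Let_def hi_def cur_def lo_def)
      have ends: "lo = old \<or> W a < psum i - psum (lo - 1)" "hi < j \<Longrightarrow> mx hi j < mx j i"
        using 3(1) low(1) by (simp_all add: lo_def hi_def)
      have time: "u2 + 180 * lo + 200 * i \<le> t + 90 * j + 90 * hi + 200 * e + 60 + (1 + btime (BNot
          (NLess (NV ''i'') (NV ''j'')))) + 60"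
        using 3(1) low(1) out(5) by (simp add: lo_def hi_def)
      \<comment> \<open>Left of \<open>lo\<close> every candidate is too heavy: by the exit
        condition of \<open>lower_prog\<close> or, if \<open>lo = old\<close>, by the assumption on
        \<open>old\<close>, as prefix sums are monotone.\<close>
      have "W a < psum i - psum x" if "x < lo" for x
      proof -
        have "psum i \<ge> psum j" "psum x \<le> psum (lo - 1)"
          using i that by (auto intro: psum_mono)
        then show ?thesis
          using ends(1) assms(14) that by auto
      qed
      then have "{x. x < j \<and> psum i - psum x \<le> W a} = {lo..<j}"
        using win(2,3,7) by (auto simp: not_le[symmetric]) (metis not_le)+
      then have left: "left_min a j i = (if hi < j then min cur (opt hi + c a * mx j i) else cur)"
        using left_min_window[of a lo hi j i] assms i win ends(2) by simp
      \<comment> \<open>Lowering \<open>i\<close> lowers both the weights and the maximum to be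
        dominated, so the same \<open>lo\<close> and \<open>hi\<close> serve the next
        iteration.\<close>
      have mono: "mx j (i - 1) \<le> mx j i" "psum (i - 1) \<le> psum i"
        by (auto intro: mx_mono psum_mono)
      have "window \<tau>2 a j (i - 1) old"
        using win mono unfolding window_def Let_def lo_def[symmetric] hi_def[symmetric]
            cur_def[symmetric]
        by (auto intro: order_trans) 
      moreover have "\<forall>q\<in>{j..e}. i - Suc 0 < q \<longrightarrow> ((rmem \<tau>2 ''L'')(off + i := left_min a j i)) (off
          + q) = left_min a j q"
        using st(3) by auto
      moreover have "\<forall>q. q \<notin> {off..off + n} \<longrightarrow> ((rmem \<tau>2 ''L'')(off + i := left_min a j i)) q =
          rmem \<sigma> ''L'' q"
        using st(4) i assms(12) by auto
      moreover have "i - Suc 0 \<le> e" "200 * i = 200 * (i - Suc 0) + 200"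
        using i assms(10) by auto
      ultimately show ?case
        using i st(2) time assms(10) left inv(7)
        by (cases "hi < j"; cases "opt hi + c a * mx j i < cur")
          (simp_all add: inv st(1) dataD[OF inv(1)] fun_upd_same fun_upd_other del: fun_upd_apply
            flip: lo_def hi_def cur_def)
    qed
  qed
next
  case (4 \<tau> u)
  then show ?case by (auto simp: window_def Let_def)
qed

end

section \<open>The dynamic program\<close>

definition phase_prog :: com where
  "phase_prog = block [
     NPut ''old'' (NGet ''ma'' (NV ''a'')), NSet ''ma'' (NV ''a'') (NV ''j''),
     extend_prog, NSet ''ea'' (NV ''a'') (NV ''e''), fill_prog]"

text \<open>\<open>ma\<close> and \<open>ea\<close> hold the first and last position of the current phase of each type.\<close>

definition right_prog :: com where
  "right_prog = block [
     NPut ''p'' (NGet ''prev'' (NV ''j'')),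
     NPut ''m'' (NGet ''ma'' (NV ''a'')),
     Cond (NLess (NV ''m'') (NV ''p''))
       (block [
          RPut ''x'' (RPlus (RGet ''D'' (NV ''p''))
            (RTimes (RGet ''c'' (NV ''a'')) (RGet ''S'' (NV ''j'')))),
          Cond (RLess (RGet ''R'' (NPlus (NV ''off'') (NV ''p''))) (RV ''x''))
            (RPut ''x'' (RGet ''R'' (NPlus (NV ''off'') (NV ''p'')))) Skip])
       (RPut ''x'' (RPlus (RGet ''D'' (NV ''m''))
          (RTimes (RGet ''c'' (NV ''a'')) (RGet ''S'' (NV ''j''))))),
     RSet ''R'' (NPlus (NV ''off'') (NV ''j'')) (RV ''x''),
     Cond (RLess (RV ''x'') (RV ''V'')) (RPut ''V'' (RV ''x'')) Skip]"

definition agent_prog :: com where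
  "agent_prog = block [
     Cond (NLess (NGet ''ea'' (NV ''a'')) (NV ''j'')) phase_prog Skip,
     RPut ''V'' (RGet ''L'' (NPlus (NV ''off'') (NV ''j''))),
     Cond (NLess (NGet ''ma'' (NV ''a'')) (NV ''j'')) right_prog Skip,
     Cond (RLess (RV ''V'') (RGet ''D'' (NV ''j''))) (RSet ''D'' (NV ''j'') (RV ''V'')) Skip]"

definition main_prog :: com where
  "main_prog = block [
     RSet ''D'' (NConst 0) (RConst 0), NPut ''j'' (NConst 0),
     While (NLess (NV ''j'') (NV ''n'')) (block [
       NInc ''j'', RSet ''D'' (NV ''j'') (RV ''top''),
       NPut ''a'' (NConst 0), NPut ''off'' (NConst 0),
       While (NLess (NV ''a'') (NV ''k'')) (block [
         NInc ''a'', NPut ''off'' (NPlus (NV ''off'') (NPlus (NV ''n'') (NConst 1))),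
         agent_prog])])]"

section \<open>Invariants of the dynamic program\<close>

context jobs
begin

text \<open>\<open>L\<close> is filled ahead for the rest \<open>j..e\<close> of the phase,
  \<open>R\<close> only for positions before \<open>j\<close>. Initially, zero entries of
  \<open>ma\<close> and \<open>ea\<close> act as a dummy phase before position 1.\<close>

definition core :: "state \<Rightarrow> nat \<Rightarrow> nat \<Rightarrow> bool" where
  "core \<sigma> a j \<longleftrightarrow> (let m = nmem \<sigma> ''ma'' a; e = nmem \<sigma> ''ea'' a; off = a * (n + 1) in
     e \<le> n \<and> (m = 0 \<or> e = n \<or> W a < psum (e + 1) - psum (m - 1)) \<and>
     (m < e \<longrightarrow> psum e - psum m \<le> W a) \<and>
     (\<forall>i\<in>{j..e}. rmem \<sigma> ''L'' (off + i) = left_min a m i) \<and>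
     (\<forall>i. m < i \<and> i < j \<longrightarrow> rmem \<sigma> ''R'' (off + i) = right_min a m i))"

lemma core_cong:
  assumes "nmem \<tau> ''ma'' a = nmem \<sigma> ''ma'' a" "nmem \<tau> ''ea'' a = nmem \<sigma> ''ea'' a"
    and "\<And>i. i \<le> n \<Longrightarrow> rmem \<tau> ''L'' (a * (n + 1) + i) = rmem \<sigma> ''L'' (a * (n + 1) + i)"
    and "\<And>i. i \<le> n \<Longrightarrow> rmem \<tau> ''R'' (a * (n + 1) + i) = rmem \<sigma> ''R'' (a * (n + 1) + i)"
    and "j \<le> n + 1" "core \<sigma> a j"
  shows "core \<tau> a j"
  using assms(3)[of] assms(4)[of] assms(1,2,5,6) unfolding core_def Let_def by auto

lemma row_disjoint:
  assumes "b \<noteq> a" "i \<le> n"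
  shows "b * (n + 1) + i \<notin> {a * (n + 1)..a * (n + 1) + n}"
proof
  assume *: "b * (n + 1) + i \<in> {a * (n + 1)..a * (n + 1) + n}"
  then obtain q where q: "b * (n + 1) + i = a * (n + 1) + q" "q \<le> n"
    by (metis atLeastAtMost_iff le_Suc_ex nat_add_left_cancel_le)
  have "(c * N + r) div N = c" if "r < N" for c N r :: nat
    using that by simp
  from this[of i "n + 1" b] this[of q "n + 1" a]
  have "(b * (n + 1) + i) div (n + 1) = b" "(a * (n + 1) + q) div (n + 1) = a"
    using assms(2) q(2) by linarith+
  with q(1) assms(1) show False by simp
qed

end

context feasible_jobs
begin

definition others_kept :: "state \<Rightarrow> state \<Rightarrow> nat \<Rightarrow> bool" where
  "others_kept \<sigma> \<tau> a \<longleftrightarrow>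
     (\<forall>b. b \<noteq> a \<longrightarrow> nmem \<tau> ''ma'' b = nmem \<sigma> ''ma'' b \<and> nmem \<tau> ''ea'' b = nmem \<sigma> ''ea'' b) \<and>
     (\<forall>q. q \<notin> {a * (n + 1)..a * (n + 1) + n} \<longrightarrow>
        rmem \<tau> ''L'' q = rmem \<sigma> ''L'' q \<and> rmem \<tau> ''R'' q = rmem \<sigma> ''R'' q)"

text \<open>The new phase raises \<open>ma + ea\<close> by \<open>(j - old) + (e - j + 1)\<close>,
  where \<open>old\<close> is the previous start. At 260 units each this pays for 60 per extension,
  200 per filled position and 180 per step of \<open>lo\<close>.\<close>

lemma phase_prog_correct:
  assumes "data \<sigma>" "nmem \<sigma> ''j'' 0 = j" "nmem \<sigma> ''a'' 0 = a" "nmem \<sigma> ''off'' 0 = a * (n + 1)"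
    "\<forall>x<j. rmem \<sigma> ''D'' x = opt x" "core \<sigma> a j" "nmem \<sigma> ''ma'' a < j" "nmem \<sigma> ''ea'' a + 1 = j"
    "a \<in> {1..k}" "j \<le> n"
  shows "wp phase_prog (\<lambda>\<tau> u. core \<tau> a j \<and> nmem \<tau> ''ma'' a = j \<and> j \<le> nmem \<tau> ''ea'' a \<and>
     others_kept \<sigma> \<tau> a \<and>
     u + 260 * (nmem \<sigma> ''ma'' a + nmem \<sigma> ''ea'' a) \<le>
       t + 260 * (nmem \<tau> ''ma'' a + nmem \<tau> ''ea'' a) + 800) \<sigma> t"
  unfolding phase_prog_def block.simps wp_Seq wp_NSet
proof (rule wp_conseq[OF extend_prog_correct[of _ j a]], goal_cases)
  case (6 \<tau>1 u1)
  then obtain e where e: "nmem \<tau>1 ''e'' 0 = e" "j \<le> e" "e \<le> n"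
     "\<forall>i\<in>{j..e}. rmem \<tau>1 ''B'' i = mx j i" "j < e \<longrightarrow> psum e - psum (j - 1) \<le> W a"
     "e < n \<longrightarrow> W a < psum (e + 1) - psum (j - 1)" "u1 + 60 * j \<le> t + 60 * e + 80"
    using assms by auto
  define \<sigma>1 where "\<sigma>1 = nupd ''ma'' a j (nupd ''old'' 0 (nmem \<sigma> ''ma'' a) \<sigma>)"
  have "frame extend_prog \<sigma>1 \<tau>1"
    using 6(2) assms by (simp add: \<sigma>1_def)
  then have fr: "\<And>x. x \<notin> {''e'', ''i''} \<Longrightarrow> nmem \<tau>1 x = nmem \<sigma>1 x"
     "\<And>x. x \<noteq> ''B'' \<Longrightarrow> rmem \<tau>1 x = rmem \<sigma>1 x"
    by (simp_all add: frame_def extend_prog_def)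
  have "data \<sigma>1" using assms(1) by (simp add: \<sigma>1_def)
  then have "data \<tau>1"
    using \<open>frame extend_prog \<sigma>1 \<tau>1\<close> by (rule data_frame) (simp_all add: extend_prog_def)
  have vals: "nmem \<tau>1 ''j'' 0 = j" "nmem \<tau>1 ''a'' 0 = a" "nmem \<tau>1 ''off'' 0 = a * (n + 1)"
     "nmem \<tau>1 ''old'' 0 = nmem \<sigma> ''ma'' a" "nmem \<tau>1 ''ma'' = (nmem \<sigma> ''ma'')(a := j)"
     "nmem \<tau>1 ''ea'' = nmem \<sigma> ''ea''" "rmem \<tau>1 ''L'' = rmem \<sigma> ''L''" "rmem \<tau>1 ''R'' = rmem \<sigma> ''R''"
     "rmem \<tau>1 ''D'' = rmem \<sigma> ''D''"
    using assms(2-4) by (simp_all add: fr \<sigma>1_def)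
  \<comment> \<open>\<open>core\<close> gives this for the previous phase, because
    \<open>ea a + 1 = j\<close>; its case \<open>ea a = n\<close> is excluded by
    \<open>j <= n\<close>.\<close>
  have old: "nmem \<sigma> ''ma'' a = 0 \<or> W a < psum j - psum (nmem \<sigma> ''ma'' a - 1)"
    using assms(6,8,10) by (auto simp: core_def Let_def)
  show ?case
    unfolding wp_Seq wp_NSet
  proof (rule wp_conseq[OF fill_prog_correct[of _ j a e "nmem \<sigma> ''ma'' a" "a * (n + 1)"]],
      goal_cases)
    case (15 \<tau>2 u2)
    define \<sigma>2 where "\<sigma>2 = nupd ''ea'' a e \<tau>1"
    have "frame fill_prog \<sigma>2 \<tau>2"
      using 15(2) vals e by (simp add: \<sigma>2_def)
    then have fr2: "nmem \<tau>2 ''ma'' = (nmem \<sigma> ''ma'')(a := j)" "nmem \<tau>2 ''ea'' = (nmem \<sigma> ''ea'')(a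
        := e)"
      "rmem \<tau>2 ''R'' = rmem \<sigma> ''R''"
      using vals by (simp_all add: frame_def fill_prog_def lower_prog_def raise_prog_def \<sigma>2_def)
    have L: "\<forall>i\<in>{j..e}. rmem \<tau>2 ''L'' (a * (n + 1) + i) = left_min a j i"
       "\<forall>q. q \<notin> {a * (n + 1)..a * (n + 1) + n} \<longrightarrow> rmem \<tau>2 ''L'' q = rmem \<sigma> ''L'' q"
       "u2 + 180 * nmem \<sigma> ''ma'' a + 200 * j \<le> u1 + 180 * j + 200 * e + 310"
      using 15(1) vals by simp_all
    have "psum (j - 1) \<le> psum j" by (simp add: psum_mono)
    then have "core \<tau>2 a j"
      unfolding core_def Let_def using L(1) e assms(10) by (auto simp: fr2)
    moreover have "others_kept \<sigma> \<tau>2 a"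
      unfolding others_kept_def using L(2) by (simp add: fr2)
    ultimately show ?case
      using L(3) e(2,7) assms(7,8) by (simp add: fr2)
  qed (use assms \<open>data \<tau>1\<close> vals e old in auto)
qed (use assms in auto)

text \<open>The tabulated left part is combined with the right part, which comes from the
  \<open>prev j\<close> entry of \<open>R\<close> by \<open>right_min_near\<close> or directly by
  \<open>right_min_far\<close>.\<close>

lemma agent_prog_correct:
  assumes "data \<sigma>" "nmem \<sigma> ''j'' 0 = j" "nmem \<sigma> ''a'' 0 = a" "nmem \<sigma> ''off'' 0 = a * (n + 1)"
    "\<forall>x<j. rmem \<sigma> ''D'' x = opt x" "core \<sigma> a j" "nmem \<sigma> ''ma'' a < j" "j \<le> nmem \<sigma> ''ea'' a + 1"
    "a \<in> {1..k}" "j \<le> n"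
  shows "wp agent_prog (\<lambda>\<tau> u. core \<tau> a (j + 1) \<and> nmem \<tau> ''ma'' a < j + 1 \<and>
      j + 1 \<le> nmem \<tau> ''ea'' a + 1 \<and>
     others_kept \<sigma> \<tau> a \<and> rmem \<tau> ''D'' = (rmem \<sigma> ''D'')(j := min (left_min a j j) (rmem \<sigma> ''D'' j)) \<and>
     u + 260 * (nmem \<sigma> ''ma'' a + nmem \<sigma> ''ea'' a) \<le>
       t + 260 * (nmem \<tau> ''ma'' a + nmem \<tau> ''ea'' a) + 1000) \<sigma> t"
proof -
  have 1: "wp (Cond (NLess (NGet ''ea'' (NV ''a'')) (NV ''j'')) phase_prog Skip)
    (\<lambda>\<tau> u. core \<tau> a j \<and> nmem \<tau> ''ma'' a \<le> j \<and> j \<le> nmem \<tau> ''ea'' a \<and> others_kept \<sigma> \<tau> a \<and>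
     u + 260 * (nmem \<sigma> ''ma'' a + nmem \<sigma> ''ea'' a) \<le>
       t + 260 * (nmem \<tau> ''ma'' a + nmem \<tau> ''ea'' a) + 820) \<sigma> t"
  proof (cases "nmem \<sigma> ''ea'' a < j")
    case True
    have "wp phase_prog (\<lambda>\<tau> u. core \<tau> a j \<and> nmem \<tau> ''ma'' a \<le> j \<and> j \<le> nmem \<tau> ''ea'' a \<and>
        others_kept \<sigma> \<tau> a \<and>
     u + 260 * (nmem \<sigma> ''ma'' a + nmem \<sigma> ''ea'' a) \<le>
       t + 260 * (nmem \<tau> ''ma'' a + nmem \<tau> ''ea'' a) + 820) \<sigma> u" if "u \<le> t + 20" for u
      by (rule wp_conseq[OF phase_prog_correct[OF assms(1-7)]]) (use True assms that in auto)
    then show ?thesis using True assms by simp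
  next
    case False
    then show ?thesis using assms by (simp add: others_kept_def)
  qed
  show ?thesis
    unfolding agent_prog_def block.simps wp_Seq
  proof (rule wp_conseq[OF 1], goal_cases)
    case (1 \<tau> u)
    have nw: "frame phase_prog \<sigma> \<tau>"
      using 1(2) by (simp add: frame_def)
    have dat: "data \<tau>"
      using assms(1) nw by (rule data_frame)
        (simp_all add: phase_prog_def extend_prog_def fill_prog_def lower_prog_def raise_prog_def)
    have vals: "nmem \<tau> ''j'' 0 = j" "nmem \<tau> ''a'' 0 = a" "nmem \<tau> ''off'' 0 = a * (n + 1)"
       "rmem \<tau> ''D'' = rmem \<sigma> ''D''"
      using nw assms(2-4)
      by (simp_all add: frame_def phase_prog_def extend_prog_def fill_prog_def lower_prog_def
          raise_prog_def)
    define m where "m = nmem \<tau> ''ma'' a"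
    define e where "e = nmem \<tau> ''ea'' a"
    have mid: "core \<tau> a j" "m \<le> j" "j \<le> e" "others_kept \<sigma> \<tau> a"
       "u + 260 * (nmem \<sigma> ''ma'' a + nmem \<sigma> ''ea'' a) \<le> t + 260 * (m + e) + 820"
      using 1(1) by (simp_all add: m_def e_def)
    have cor: "e \<le> n" "m = 0 \<or> e = n \<or> W a < psum (e + 1) - psum (m - 1)"
     "m < e \<Longrightarrow> psum e - psum m \<le> W a"
     "\<forall>i\<in>{j..e}. rmem \<tau> ''L'' (a * (n + 1) + i) = left_min a m i"
     "\<forall>i. m < i \<and> i < j \<longrightarrow> rmem \<tau> ''R'' (a * (n + 1) + i) = right_min a m i"
      using mid(1) by (simp_all add: core_def Let_def m_def e_def)
    have "j \<ge> 1" using assms(7) by simp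
    define p where "p = nmem \<tau> ''prev'' j"
    have p: "prev_greater j p"
      unfolding p_def using dat \<open>j \<ge> 1\<close> assms(10) by (rule dataD)
    \<comment> \<open>After the phase test only row \<open>a\<close> of \<open>R\<close> can change
      among the arrays in \<open>core\<close>; once its entries up to \<open>j\<close> are correct,
      the invariant advances.\<close>
    have keep: "core \<tau>' a (Suc j) \<and> others_kept \<sigma> \<tau>' a"
      if "nmem \<tau>' ''ma'' = nmem \<tau> ''ma''" "nmem \<tau>' ''ea'' = nmem \<tau> ''ea''"
        "rmem \<tau>' ''L'' = rmem \<tau> ''L''" "rmem \<tau>' ''R'' = Rnew"
        "\<And>i. m < i \<Longrightarrow> i \<le> j \<Longrightarrow> Rnew (a * (n + 1) + i) = right_min a m i"
        "\<And>q. q \<notin> {a * (n + 1)..a * (n + 1) + n} \<Longrightarrow> Rnew q = rmem \<tau> ''R'' q" for \<tau>' Rnew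
    proof
      show "core \<tau>' a (Suc j)"
        using cor that(5) unfolding core_def Let_def by (auto simp: that(1-4) simp flip: m_def
            e_def)
      show "others_kept \<sigma> \<tau>' a"
        using mid(4) that(6) unfolding others_kept_def by (simp add: that(1-4))
    qed
    have Lj: "rmem \<tau> ''L'' (a * (n + 1) + j) = left_min a m j"
      using cor(4) mid(3) by simp
    have eqs: "nmem \<tau> ''ma'' a = m" "nmem \<tau> ''ea'' a = e" "nmem \<tau> ''prev'' j = p"
      by (simp_all add: m_def e_def p_def)
    show ?case
    proof (cases "m < j")
      case False
      \<comment> \<open>At the first position of a phase no candidate lies to the right of the
        start, and \<open>L\<close> alone gives \<open>left_min a j j\<close>.\<close>
      then have "m = j" using mid(2) by simp
      then have "core \<tau>' a (Suc j) \<and> others_kept \<sigma> \<tau>' a"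
        if "nmem \<tau>' ''ma'' = nmem \<tau> ''ma''" "nmem \<tau>' ''ea'' = nmem \<tau> ''ea''"
        "rmem \<tau>' ''L'' = rmem \<tau> ''L''" "rmem \<tau>' ''R'' = rmem \<tau> ''R''" for \<tau>'
        using that by (intro keep[OF that]) auto
      then show ?thesis
        using mid(3,5) \<open>m = j\<close> Lj
        by (cases "left_min a j j < rmem \<sigma> ''D'' j") (simp_all add: vals eqs fun_upd_idem)
    next
      case True
      \<comment> \<open>\<open>m\<close> is light enough at the end \<open>e\<close> of the phase,
        hence also at \<open>j\<close>.\<close>
      have "psum j \<le> psum e" using mid(3) by (rule psum_mono)
      then have split: "left_min a j j = min (left_min a m j) (right_min a m j)"
        using cor(3) mid(3) True by (intro left_min_split) auto
      have "core \<tau>' a (Suc j) \<and> others_kept \<sigma> \<tau>' a"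
        if "nmem \<tau>' ''ma'' = nmem \<tau> ''ma''" "nmem \<tau>' ''ea'' = nmem \<tau> ''ea''"
        "rmem \<tau>' ''L'' = rmem \<tau> ''L''"
        "rmem \<tau>' ''R'' = (rmem \<tau> ''R'')(a * (n + 1) + j := right_min a m j)" for \<tau>'
        using cor(5) assms(10) by (intro keep[OF that]) auto
      note keep' = this
      have right: "right_min a m j =
          (if m < p then min (opt p + c a * s j) (right_min a m p) else opt m + c a * s j)"
        using right_min_near[OF p _ assms(10,9)] right_min_far[OF p _ True assms(10,9)] by simp
      have Rp: "rmem \<tau> ''R'' (a * (n + 1) + p) = right_min a m p" if "m < p"
        using cor(5) that p by (simp add: prev_greater_def)
      have "p < j" using p by (simp add: prev_greater_def)
      have D: "rmem \<sigma> ''D'' p = opt p" "rmem \<sigma> ''D'' m = opt m"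
        using assms(5) True \<open>p < j\<close> by simp_all
      show ?thesis
      proof (cases "m < p")
        case far: True
        show ?thesis
          using mid(3,5) True far Rp[OF far] Lj right split keep' D
          by (cases "right_min a m p < opt p + c a * s j"; cases "right_min a m j < left_min a m j";
              cases "left_min a j j < rmem \<sigma> ''D'' j")
            (simp_all add: vals eqs dataD[OF dat] \<open>j \<ge> 1\<close> assms(10) right_prog_def fun_upd_idem
                fun_upd_same fun_upd_other del: fun_upd_apply)
      next
        case near: False
        show ?thesis
          using mid(3,5) True near Lj right split keep' D
          by (cases "right_min a m j < left_min a m j";
              cases "left_min a j j < rmem \<sigma> ''D'' j")
            (simp_all add: vals eqs dataD[OF dat] \<open>j \<ge> 1\<close> assms(10) right_prog_def fun_upd_idem
                fun_upd_same fun_upd_other del: fun_upd_apply)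
      qed
    qed
  qed
qed

end

section \<open>Readiness of the types and amortized time\<close>

context feasible_jobs
begin

definition ready :: "state \<Rightarrow> nat \<Rightarrow> nat \<Rightarrow> bool" where
  "ready \<sigma> a j \<longleftrightarrow> core \<sigma> a j \<and> nmem \<sigma> ''ma'' a < j \<and> j \<le> nmem \<sigma> ''ea'' a + 1"

text \<open>A phase of a type is paid for by the increase of its bounds.\<close>

definition progress :: "state \<Rightarrow> nat" where
  "progress \<sigma> = (\<Sum>a\<in>{1..k}. nmem \<sigma> ''ma'' a + nmem \<sigma> ''ea'' a)"

lemma ready_others_kept:
  assumes "ready \<sigma> b j" "others_kept \<sigma> \<tau> a" "b \<noteq> a" "j \<le> n + 1"
  shows "ready \<tau> b j"
  using assms row_disjoint[OF assms(3)] core_cong[of \<tau> b \<sigma> j]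
  by (simp add: ready_def others_kept_def)

lemma ready_nupd [simp]:
  "x \<notin> {''ma'', ''ea''} \<Longrightarrow> ready (nupd x q m \<sigma>) b j \<longleftrightarrow> ready \<sigma> b j"
  by (auto simp: ready_def core_def)

lemma ready_rupd [simp]:
  "x \<notin> {''L'', ''R''} \<Longrightarrow> ready (rupd x q m \<sigma>) b j \<longleftrightarrow> ready \<sigma> b j"
  by (auto simp: ready_def core_def)

lemma progress_nupd [simp]: "x \<notin> {''ma'', ''ea''} \<Longrightarrow> progress (nupd x q m \<sigma>) = progress \<sigma>"
  by (auto simp: progress_def)

lemma progress_rupd [simp]: "progress (rupd x q m \<sigma>) = progress \<sigma>"
  by (simp add: progress_def)

lemma progress_others_kept:
  assumes "others_kept \<sigma> \<tau> a" "a \<in> {1..k}"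
  shows "progress \<tau> + (nmem \<sigma> ''ma'' a + nmem \<sigma> ''ea'' a) =
    progress \<sigma> + (nmem \<tau> ''ma'' a + nmem \<tau> ''ea'' a)"
proof -
  have "(\<Sum>b\<in>{1..k} - {a}. nmem \<tau> ''ma'' b + nmem \<tau> ''ea'' b) =
      (\<Sum>b\<in>{1..k} - {a}. nmem \<sigma> ''ma'' b + nmem \<sigma> ''ea'' b)"
    using assms(1) by (intro sum.cong) (auto simp: others_kept_def)
  then show ?thesis
    unfolding progress_def using assms(2) by (simp add: sum.remove)
qed

text \<open>Both bounds of a phase lie in \<open>0..n\<close>; this limits what all phases of all
  types can charge to \<open>progress\<close>.\<close>

lemma progress_le:
  assumes "\<forall>a\<in>{1..k}. ready \<sigma> a j" "j \<le> n + 1"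
  shows "progress \<sigma> \<le> 2 * n * k"
proof -
  have "progress \<sigma> \<le> (\<Sum>a\<in>{1..k}. 2 * n)"
    unfolding progress_def using assms
    by (intro sum_mono) (fastforce simp: ready_def core_def Let_def)
  then show ?thesis by (simp add: mult.commute)
qed

text \<open>The end \<open>a = k\<close> of one round and the start \<open>a = 0\<close> of the next
  are the same condition.\<close>

definition ready_agents :: "state \<Rightarrow> nat \<Rightarrow> nat \<Rightarrow> bool" where
  "ready_agents \<sigma> a j \<longleftrightarrow> (\<forall>b\<in>{1..a}. ready \<sigma> b (j + 1)) \<and> (\<forall>b\<in>{a<..k}. ready \<sigma> b j)"

lemma ready_agents_nupd [simp]:
  "x \<notin> {''ma'', ''ea''} \<Longrightarrow> ready_agents (nupd x q m \<sigma>) a j \<longleftrightarrow> ready_agents \<sigma> a j"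
  by (simp add: ready_agents_def)

lemma ready_agents_rupd [simp]:
  "x \<notin> {''L'', ''R''} \<Longrightarrow> ready_agents (rupd x q m \<sigma>) a j \<longleftrightarrow> ready_agents \<sigma> a j"
  by (simp add: ready_agents_def)

text \<open>The factor 1100 covers the constant work per position and type, and 520 is twice the 260
  units charged to \<open>progress\<close>.\<close>

lemma main_prog_correct:
  assumes "data \<sigma>" "\<forall>a\<in>{1..k}. nmem \<sigma> ''ma'' a = 0 \<and> nmem \<sigma> ''ea'' a = 0"
  shows "wp main_prog (\<lambda>\<tau> u. data \<tau> \<and> (\<forall>x\<le>n. rmem \<tau> ''D'' x = opt x) \<and>
     u \<le> t + 520 * (n * k) + n * (1100 * k + 100) + 100) \<sigma> t"
  unfolding main_prog_def block.simps wp_Seq wp_NSet wp_RSet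
proof (rule wp_While[where J = "\<lambda>\<tau> u. data \<tau> \<and> nmem \<tau> ''j'' 0 \<le> n \<and>
     (\<forall>x\<le>nmem \<tau> ''j'' 0. rmem \<tau> ''D'' x = opt x) \<and> ready_agents \<tau> k (nmem \<tau> ''j'' 0) \<and>
     u \<le> t + 260 * progress \<tau> + nmem \<tau> ''j'' 0 * (1100 * k + 100) + 20"
   and N = "t + 260 * (2 * n * k) + n * (1100 * k + 100) + 20"], goal_cases)
  case 1
  show ?case using assms
    by (simp add: ready_agents_def) (simp add: ready_def core_def)
next
  case (2 \<tau> u)
  then have "progress \<tau> \<le> 2 * n * k"
    by (intro progress_le[of _ "nmem \<tau> ''j'' 0 + 1"]) (auto simp: ready_agents_def)
  moreover have "nmem \<tau> ''j'' 0 * (1100 * k + 100) \<le> n * (1100 * k + 100)"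
    using 2 by (intro mult_right_mono) auto
  ultimately show ?case using 2 by linarith
next
  case (3 \<sigma>' v)
  define j where "j = nmem \<sigma>' ''j'' 0 + 1"
  define T where "T = t + nmem \<sigma>' ''j'' 0 * (1100 * k + 100) + 60"
  have j: "1 \<le> j" "j \<le> n" using 3 by (auto simp: j_def dataD)
  have pre: "data \<sigma>'" "\<forall>x<j. rmem \<sigma>' ''D'' x = opt x" "ready_agents \<sigma>' 0 j" "v + 40 \<le> T + 260 *
      progress \<sigma>'"
      "nmem \<sigma>' ''j'' 0 = j - 1"
    using 3(1) by (auto simp: j_def less_Suc_eq_le ready_agents_def T_def)
  show ?case
    unfolding block.simps wp_Seq wp_NSet wp_RSet
  \<comment> \<open>\<open>D j\<close> starts at the cap, the \<open>cmin\<close> over no types, and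
    takes in one type per iteration. \<open>off\<close> advances by the row length because the
    machine cannot multiply naturals.\<close>
  proof (rule wp_While[where J = "\<lambda>\<tau> u. data \<tau> \<and> nmem \<tau> ''j'' 0 = j \<and>
     (\<forall>x<j. rmem \<tau> ''D'' x = opt x) \<and> nmem \<tau> ''a'' 0 \<le> k \<and>
         nmem \<tau> ''off'' 0 = nmem \<tau> ''a'' 0 * (n + 1) \<and>
     rmem \<tau> ''D'' j = cmin (\<lambda>b. left_min b j j) {1..nmem \<tau> ''a'' 0} \<and>
     ready_agents \<tau> (nmem \<tau> ''a'' 0) j \<and> u \<le> T + 260 * progress \<tau> + 1100 * nmem \<tau> ''a'' 0"
    and N = "T + 260 * (2 * n * k) + 1100 * k"], goal_cases)
    case 1
    show ?case
      using pre j by (simp add: dataD)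
  next
    case (2 \<tau> u)
    then have "ready \<tau> b (if b \<le> nmem \<tau> ''a'' 0 then j + 1 else j)" if "b \<in> {1..k}" for b
      using that by (auto simp: ready_agents_def)
    then have "progress \<tau> \<le> (\<Sum>a\<in>{1..k}. 2 * n)"
      unfolding progress_def using j
      by (intro sum_mono) (fastforce simp: ready_def core_def Let_def split: if_splits)
    then have "progress \<tau> \<le> 2 * n * k" by (simp add: mult.commute)
    with 2 show ?case by linarith
  next
    case (3 \<tau> u)
    define a where "a = nmem \<tau> ''a'' 0 + 1"
    define \<sigma>2 where "\<sigma>2 = nupd ''off'' 0 (a * (n + 1)) (nupd ''a'' 0 a \<tau>)"
    have a: "a \<in> {1..k}" "nmem \<tau> ''a'' 0 = a - 1" using 3 by (auto simp: a_def dataD)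
    have pre2: "data \<sigma>2" "nmem \<sigma>2 ''j'' 0 = j" "nmem \<sigma>2 ''a'' 0 = a" "nmem \<sigma>2 ''off'' 0 = a * (n +
        1)"
      "\<forall>x<j. rmem \<sigma>2 ''D'' x = opt x" "rmem \<sigma>2 ''D'' j = cmin (\<lambda>b. left_min b j j) {1..a - 1}"
      "ready_agents \<sigma>2 (a - 1) j" "u \<le> T + 260 * progress \<sigma>2 + 1100 * (a - 1)"
      using 3(1) a by (simp_all add: \<sigma>2_def)
    have "ready \<sigma>2 a j" using pre2(7) a by (simp add: ready_agents_def)
    then have rd: "core \<sigma>2 a j" "nmem \<sigma>2 ''ma'' a < j" "j \<le> nmem \<sigma>2 ''ea'' a + 1"
      by (simp_all add: ready_def)
    have wp: "wp agent_prog (\<lambda>\<tau> u. data \<tau> \<and> nmem \<tau> ''j'' 0 = j \<and>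
      (\<forall>x<j. rmem \<tau> ''D'' x = opt x) \<and> nmem \<tau> ''a'' 0 = a \<and> nmem \<tau> ''off'' 0 = a * (n + 1) \<and>
      rmem \<tau> ''D'' j = cmin (\<lambda>b. left_min b j j) {1..a} \<and>
      ready_agents \<tau> a j \<and> u \<le> T + 260 * progress \<tau> + 1100 * a) \<sigma>2 u'"
      if "u' \<le> u + 40" for u'
    proof (rule wp_conseq[OF agent_prog_correct[OF pre2(1-5) rd a(1) j(2)]], goal_cases)
      case (1 \<tau>' y)
      have "data \<tau>'"
        using pre2(1) 1(2) by (rule data_frame) (simp_all add: agent_prog_def right_prog_def
          phase_prog_def extend_prog_def fill_prog_def lower_prog_def raise_prog_def)
      moreover have "nmem \<tau>' ''j'' = nmem \<sigma>2 ''j''" "nmem \<tau>' ''a'' = nmem \<sigma>2 ''a''"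
          "nmem \<tau>' ''off'' = nmem \<sigma>2 ''off''"
        using 1(2) by (simp_all add: frame_def agent_prog_def right_prog_def
          phase_prog_def extend_prog_def fill_prog_def lower_prog_def raise_prog_def)
      moreover have kept: "others_kept \<sigma>2 \<tau>' a" and new: "ready \<tau>' a (j + 1)"
        using 1(1) by (simp_all add: ready_def)
      have "ready_agents \<tau>' a j"
        unfolding ready_agents_def
      proof (intro conjI ballI)
        fix b assume "b \<in> {1..a}"
        then show "ready \<tau>' b (j + 1)"
          using new pre2(7) j(2) by (cases "b = a")
            (auto simp: ready_agents_def intro!: ready_others_kept[OF _ kept])
      next
        fix b assume "b \<in> {a<..k}"
        then show "ready \<tau>' b j"
          using pre2(7) j(2) by (auto simp: ready_agents_def intro!: ready_others_kept[OF _ kept])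
      qed
      moreover have "{1..a} = insert a {1..a - 1}" using a by auto
      then have "cmin (\<lambda>b. left_min b j j) {1..a} =
          min (left_min a j j) (cmin (\<lambda>b. left_min b j j) {1..a - 1})"
        by (simp add: cmin_insert)
      moreover have "y \<le> T + 260 * progress \<tau>' + 1100 * a"
      proof -
        have "1100 * (a - 1) + 1100 = 1100 * a" using a by auto
        moreover have "y + 260 * (nmem \<sigma>2 ''ma'' a + nmem \<sigma>2 ''ea'' a) \<le>
            u' + 260 * (nmem \<tau>' ''ma'' a + nmem \<tau>' ''ea'' a) + 1000"
          using 1(1) by blast
        moreover have "y \<le> T + 260 * p' + 1100 * a"
          if "y + 260 * q \<le> u' + 260 * q' + 1000" "p' + q = p + q'" "u \<le> T + 260 * p + 1100 * r"
            "u' \<le> u + 40" "1100 * r + 1100 = 1100 * a" for p p' q q' r :: nat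
          using that by linarith
        ultimately show ?thesis
          using pre2(8) that progress_others_kept[OF kept a(1)] by blast
      qed
      ultimately show ?case
        using 1(1) pre2 by simp
    qed
    \<comment> \<open>This is the state that symbolic execution produces; the running sum in
      \<open>off\<close> is \<open>a * (n + 1)\<close>.\<close>
    have st: "\<sigma>2 = nupd ''off'' q r (nupd ''a'' q' r' \<tau>)"
      if "q = 0" "q' = 0" "r = nmem \<tau> ''off'' 0 + (n + 1)" "r' = a" for q q' r r'
      using 3(1) that by (simp add: \<sigma>2_def a_def algebra_simps)
    show ?case
      unfolding block.simps wp_Seq wp_NSet
      by (rule back_subst[of "\<lambda>\<sigma>. wp agent_prog _ \<sigma> _", OF wp_conseq[OF wp] st])
        (use 3(1) a(1) in \<open>simp_all add: a_def dataD\<close>)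
  next
    case (4 \<tau> u)
    then have *: "nmem \<tau> ''a'' 0 = k" by (simp add: dataD)
    then have "rmem \<tau> ''D'' j = opt j"
      using 4(1) j by (simp add: opt_eq)
    then have "\<forall>x\<le>j. rmem \<tau> ''D'' x = opt x"
      using 4(1) by (simp add: le_less)
    moreover have "ready_agents \<tau> k j" using 4(1) * by simp
    moreover have "j * (1100 * k + 100) = (j - 1) * (1100 * k + 100) + (1100 * k + 100)"
      using j by (cases j) auto
    ultimately show ?case
      using 4(1) j pre(5) * by (simp add: T_def)
  qed
next
  case (4 \<tau> u)
  then have "progress \<tau> \<le> 2 * n * k"
    by (intro progress_le[of _ "nmem \<tau> ''j'' 0 + 1"]) (auto simp: ready_agents_def)
  moreover have "nmem \<tau> ''j'' 0 = n"
    using 4 by (simp add: dataD)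
  ultimately show ?case using 4 by (simp add: algebra_simps)
qed

end

section \<open>Recovering a solution\<close>

definition scan_prog :: com where
  "scan_prog =
       While (NLess (NV ''a'') (NV ''k'')) (block [
         NInc ''a'',
         Cond (BAnd
             (BNot (RLess (RGet ''w0'' (NV ''a''))
               (RMinus (RGet ''P'' (NV ''j'')) (RGet ''P'' (NV ''i'')))))
             (BNot (RLess (RGet ''D'' (NV ''j''))
               (RPlus (RGet ''D'' (NV ''i'')) (RTimes (RGet ''c'' (NV ''a'')) (RV ''M''))))))
           (NPut ''found'' (NV ''a'')) Skip])"

definition commit_prog :: com where
  "commit_prog =
       Cond (NLess (NConst 0) (NV ''found''))
         (block [
            NInc ''groups'',
            NSet ''last'' (NV ''groups'') (NMinus (NV ''n'') (NV ''i'')),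
            NSet ''type'' (NV ''groups'') (NV ''found''),
            NPut ''j'' (NV ''i''), RPut ''M'' (RConst 0)])
         Skip"

text \<open>\<open>i\<close> descends once from \<open>n\<close> to 0 and does not restart when a
  group is found, so each pair of a position and a type is tested at most once.\<close>

definition trace_prog :: com where
  "trace_prog = block [
     NPut ''j'' (NV ''n''), NPut ''i'' (NV ''n''), NPut ''groups'' (NConst 0), RPut ''M'' (RConst
         0),
     While (NLess (NConst 0) (NV ''i'')) (block [
       Cond (RLess (RV ''M'') (RGet ''S'' (NV ''i''))) (RPut ''M'' (RGet ''S'' (NV ''i''))) Skip,
       NPut ''i'' (NMinus (NV ''i'') (NConst 1)),
       NPut ''found'' (NConst 0), NPut ''a'' (NConst 0),
       scan_prog, commit_prog])]"

text \<open>Instances with \<open>n = 0\<close> or \<open>k = 0\<close> are answered at once, since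
  linear preprocessing would exceed the bound. \<open>feasible\<close> is initially 0 and stays so
  on infeasible instances.\<close>

definition solve_prog :: com where
  "solve_prog =
     Cond (NLess (NConst 0) (NV ''n''))
       (Cond (NLess (NConst 0) (NV ''k''))
         (block [
            totals_prog, copy_prog, prev_prog,
            Cond (NLess (NConst 0) (NV ''bad'')) Skip
              (block [
                 RPut ''top'' (RTimes (RV ''csum'') (RV ''ssum'')),
                 main_prog, trace_prog, NPut ''feasible'' (NConst 1)])])
         Skip)
       (NPut ''feasible'' (NConst 1))"

section \<open>Correctness of the reconstruction\<close>

context feasible_jobs
begin

definition admissible :: "nat \<Rightarrow> nat \<Rightarrow> nat \<Rightarrow> bool" where
  "admissible a i j \<longleftrightarrow> a \<in> {1..k} \<and> psum j - psum i \<le> W a \<and> opt i + c a * mx i j \<le> opt j"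

lemma trace_prog_correct:
  assumes "data \<sigma>" "\<forall>x\<le>n. rmem \<sigma> ''D'' x = opt x" "nmem \<sigma> ''last'' 0 = 0"
  shows "wp trace_prog (\<lambda>\<tau> u. chain (nmem \<tau> ''last'') (nmem \<tau> ''type'') (nmem \<tau> ''groups'' 0) 0 \<and>
     u \<le> t + n * (100 * k + 100) + 100) \<sigma> t"
proof -
  \<comment> \<open>All candidates from \<open>i\<close> up to \<open>j - 1\<close> have been
    rejected for \<open>j\<close>; with \<open>opt_attained\<close> this forces \<open>j = 0\<close>
    once \<open>i = 0\<close>.\<close>
  define J where "J = (\<lambda>\<tau> u. data \<tau> \<and> (\<forall>x\<le>n. rmem \<tau> ''D'' x = opt x) \<and>
     nmem \<tau> ''i'' 0 \<le> nmem \<tau> ''j'' 0 \<and> nmem \<tau> ''j'' 0 \<le> n \<and>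
     rmem \<tau> ''M'' 0 = mx (nmem \<tau> ''i'' 0) (nmem \<tau> ''j'' 0) \<and>
     chain (nmem \<tau> ''last'') (nmem \<tau> ''type'') (nmem \<tau> ''groups'' 0) (nmem \<tau> ''j'' 0) \<and>
     (\<forall>x a. nmem \<tau> ''i'' 0 \<le> x \<and> x < nmem \<tau> ''j'' 0 \<longrightarrow> \<not> admissible a x (nmem \<tau> ''j'' 0)) \<and>
     u + nmem \<tau> ''i'' 0 * (100 * k + 100) \<le> t + n * (100 * k + 100) + 40)"
  show ?thesis
    unfolding trace_prog_def block.simps wp_Seq wp_NSet wp_RSet
proof (rule wp_While[where J = J
   and N = "t + n * (100 * k + 100) + 40"], goal_cases)
  case 1
  show ?case using assms unfolding J_def by (auto simp: dataD chain_0)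
next
  case (2 \<tau> u)
  then show ?case unfolding J_def by linarith
next
  case (3 \<sigma>' v)
  define i where "i = nmem \<sigma>' ''i'' 0 - 1"
  define j where "j = nmem \<sigma>' ''j'' 0"
  define T where "T = v + 50"
  have i: "nmem \<sigma>' ''i'' 0 = Suc i" using 3(2) by (simp add: i_def)
  have inv: "data \<sigma>'" "\<forall>x\<le>n. rmem \<sigma>' ''D'' x = opt x" "i < j" "j \<le> n" "rmem \<sigma>' ''M'' 0 = mx (Suc
      i) j"
    "chain (nmem \<sigma>' ''last'') (nmem \<sigma>' ''type'') (nmem \<sigma>' ''groups'' 0) j"
    "\<And>x a. Suc i \<le> x \<Longrightarrow> x < j \<Longrightarrow> \<not> admissible a x j"
    "v + Suc i * (100 * k + 100) \<le> t + n * (100 * k + 100) + 40"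
    using 3(1) unfolding J_def by (simp_all add: i flip: j_def)
  have S: "rmem \<sigma>' ''S'' (Suc i) = s (Suc i)" using inv by (intro dataD) auto
  have step: "mx i j = max (mx (Suc i) j) (s (Suc i))" using inv(3) by (rule mx_step)
  have inner: "wp scan_prog
      (\<lambda>\<tau> u. (if nmem \<tau> ''found'' 0 = 0 then \<forall>a. \<not> admissible a i j
          else admissible (nmem \<tau> ''found'' 0) i j) \<and> u \<le> T + 100 * k + 10) \<sigma>1 u1"
    if st: "data \<sigma>1" "\<forall>x\<le>n. rmem \<sigma>1 ''D'' x = opt x" "nmem \<sigma>1 ''i'' 0 = i" "nmem \<sigma>1 ''j'' 0 = j"
       "rmem \<sigma>1 ''M'' 0 = mx i j" "nmem \<sigma>1 ''found'' 0 = 0" "nmem \<sigma>1 ''a'' 0 = 0" "u1 \<le> T" for \<sigma>1 u1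
    unfolding scan_prog_def
  proof (rule wp_While[where J = "\<lambda>\<tau> u. data \<tau> \<and> (\<forall>x\<le>n. rmem \<tau> ''D'' x = opt x) \<and>
       nmem \<tau> ''i'' 0 = i \<and> nmem \<tau> ''j'' 0 = j \<and> rmem \<tau> ''M'' 0 = mx i j \<and> nmem \<tau> ''a'' 0 \<le> k \<and>
       (if nmem \<tau> ''found'' 0 = 0 then \<forall>a\<in>{1..nmem \<tau> ''a'' 0}. \<not> admissible a i j
          else admissible (nmem \<tau> ''found'' 0) i j) \<and> u \<le> T + 100 * nmem \<tau> ''a'' 0"
     and N = "T + 100 * k"], goal_cases)
    case 1
    show ?case using st by simp
  next
    case (2 \<tau> u)
    then show ?case by linarith
  next
    case (3 \<tau> u)
    define a where "a = nmem \<tau> ''a'' 0"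
    have vals: "rmem \<tau> ''P'' j = psum j" "rmem \<tau> ''P'' i = psum i" "rmem \<tau> ''D'' j = opt j" "rmem
        \<tau> ''D'' i = opt i"
      using 3(1) inv(3,4) by (simp_all add: dataD)
    have "Suc a \<le> k" using 3 by (simp add: dataD a_def)
    have adm: "admissible (Suc a) i j \<longleftrightarrow> psum j - psum i \<le> W (Suc a) \<and>
        opt i + c (Suc a) * mx i j \<le> opt j"
      using \<open>Suc a \<le> k\<close> by (simp add: admissible_def)
    show ?case
      using 3(1) \<open>Suc a \<le> k\<close> vals adm
      by (cases "admissible (Suc a) i j")
        (auto simp: dataD atLeastAtMostSuc_conv not_less simp flip: a_def split: if_splits)
  next
    case (4 \<tau> u)
    then have "nmem \<tau> ''a'' 0 = k" by (simp add: dataD)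
    moreover have "(\<forall>a. \<not> admissible a i j) \<longleftrightarrow> (\<forall>a\<in>{1..k}. \<not> admissible a i j)"
      by (auto simp: admissible_def)
    ultimately show ?case using 4(1) by simp
  qed
  have rest: "wp scan_prog (wp commit_prog J) \<sigma>1 u1"
    if st: "data \<sigma>1" "\<forall>x\<le>n. rmem \<sigma>1 ''D'' x = opt x" "nmem \<sigma>1 ''i'' 0 = i" "nmem \<sigma>1 ''j'' 0 = j"
       "rmem \<sigma>1 ''M'' 0 = mx i j" "nmem \<sigma>1 ''found'' 0 = 0" "nmem \<sigma>1 ''a'' 0 = 0" "u1 \<le> T"
       "nmem \<sigma>1 ''last'' = nmem \<sigma>' ''last''" "nmem \<sigma>1 ''type'' = nmem \<sigma>' ''type''"
       "nmem \<sigma>1 ''groups'' = nmem \<sigma>' ''groups''" for \<sigma>1 u1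
  proof (rule wp_conseq[OF inner[OF st(1-8)]], goal_cases)
    case (1 \<tau> u)
    have "data \<tau>"
      using st(1) 1(2) by (rule data_frame) (simp_all add: scan_prog_def)
    moreover have "rmem \<tau> ''D'' = rmem \<sigma>1 ''D''" "nmem \<tau> ''i'' = nmem \<sigma>1 ''i''" "nmem \<tau> ''j'' =
        nmem \<sigma>1 ''j''"
       "rmem \<tau> ''M'' = rmem \<sigma>1 ''M''" "nmem \<tau> ''last'' = nmem \<sigma>' ''last''" "nmem \<tau> ''type'' = nmem
           \<sigma>' ''type''"
       "nmem \<tau> ''groups'' = nmem \<sigma>' ''groups''"
      using 1(2) st by (simp_all add: frame_def scan_prog_def)
    ultimately have \<tau>: "data \<tau>" "\<forall>x\<le>n. rmem \<tau> ''D'' x = opt x" "nmem \<tau> ''i'' 0 = i" "nmem \<tau> ''j''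
        0 = j"
       "rmem \<tau> ''M'' 0 = mx i j" "nmem \<tau> ''last'' = nmem \<sigma>' ''last''" "nmem \<tau> ''type'' = nmem \<sigma>'
           ''type''"
       "nmem \<tau> ''groups'' = nmem \<sigma>' ''groups''"
      using st by simp_all
    have time: "u + 50 + i * (100 * k + 100) \<le> t + n * (100 * k + 100) + 40 + 10"
      using 1(1) inv(8) by (simp add: T_def)
    show ?case
    proof (cases "nmem \<tau> ''found'' 0 = 0")
      case True
      have "\<not> admissible a x j" if "i \<le> x" "x < j" for x a
        using True 1(1) inv(7)[of x a] that by (cases "x = i") auto
      then show ?thesis
        using True time inv(3,4,6) \<tau> by (simp add: commit_prog_def J_def)
    next
      case False
      then have adm: "admissible (nmem \<tau> ''found'' 0) i j" using 1(1) by simp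
      have "chain ((nmem \<sigma>' ''last'')(Suc (nmem \<sigma>' ''groups'' 0) := n - i))
          ((nmem \<sigma>' ''type'')(Suc (nmem \<sigma>' ''groups'' 0) := nmem \<tau> ''found'' 0)) (Suc (nmem \<sigma>'
              ''groups'' 0)) i"
        using adm by (intro chain_Suc[OF inv(6,3,4)]) (auto simp: admissible_def)
      then show ?thesis
        using False time inv(3,4) \<tau>
        by (simp add: commit_prog_def J_def dataD fun_upd_same fun_upd_other del: fun_upd_apply)
            auto
    qed
  qed
  show ?case
    unfolding block.simps wp_Seq
    using inv step S i
    by (cases "mx (Suc i) j < s (Suc i)") (auto simp: T_def j_def[symmetric] intro!: rest)
next
  case (4 \<tau> u)
  then have i: "nmem \<tau> ''i'' 0 = 0" by simp
  have "nmem \<tau> ''j'' 0 = 0"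
  proof (rule ccontr)
    assume "nmem \<tau> ''j'' 0 \<noteq> 0"
    then obtain a x where "a \<in> {1..k}" "x < nmem \<tau> ''j'' 0" "psum (nmem \<tau> ''j'' 0) - psum x \<le> W a"
      "opt (nmem \<tau> ''j'' 0) = opt x + c a * mx x (nmem \<tau> ''j'' 0)"
      using opt_attained[of "nmem \<tau> ''j'' 0"] 4(1)[unfolded J_def] by auto
    then have "admissible a x (nmem \<tau> ''j'' 0)" by (simp add: admissible_def)
    with 4(1)[unfolded J_def] i \<open>x < _\<close> show False by simp
  qed
  with 4(1)[unfolded J_def] i show ?case by simp
qed
qed

lemma optimize_correct:
  assumes I: "represents I" and "data \<sigma>" and n: "0 < n" "0 < k"
    and "\<forall>a\<in>{1..k}. nmem \<sigma> ''ma'' a = 0 \<and> nmem \<sigma> ''ea'' a = 0" "nmem \<sigma> ''last'' 0 = 0"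
  shows "wp (block [main_prog, trace_prog, NPut ''feasible'' (NConst 1)])
    (\<lambda>\<tau> u. correct_output I \<tau> \<and> u \<le> t + 2300 * (n * k)) \<sigma> t"
  unfolding block.simps wp_Seq
proof (rule wp_conseq[OF main_prog_correct[OF assms(2,5)]], goal_cases)
  case (1 \<tau> u)
  have "nmem \<tau> ''last'' = nmem \<sigma> ''last''"
    using 1(2) by (simp add: frame_def main_prog_def agent_prog_def right_prog_def
      phase_prog_def extend_prog_def fill_prog_def lower_prog_def raise_prog_def)
  with 1(1) assms(6) have *: "data \<tau>" "\<forall>x\<le>n. rmem \<tau> ''D'' x = opt x" "nmem \<tau> ''last'' 0 = 0"
    "u \<le> t + 520 * (n * k) + n * (1100 * k + 100) + 100"
    by simp_all
  show ?case
  proof (rule wp_conseq[OF trace_prog_correct[OF *(1-3)]], goal_cases)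
    case (1 \<tau>' v)
    define e where "e = nmem \<tau>' ''last''"
    define ty where "ty = nmem \<tau>' ''type''"
    define g where "g = nmem \<tau>' ''groups'' 0"
    have "chain e ty g 0" using 1(1) by (simp add: e_def ty_def g_def)
    from chain_optimal[OF I this] obtain \<alpha>
      where \<alpha>: "\<forall>h\<in>{1..g}. \<alpha> {e (h - 1)<..e h} = ty h"
        "optimal_solution I ((\<lambda>h. {e (h - 1)<..e h}) ` {1..g}) \<alpha>" by blast
    have "output_solution (nupd ''feasible'' 0 1 \<tau>') ((\<lambda>h. {e (h - 1)<..e h}) ` {1..g}) \<alpha>"
      unfolding output_solution_def Let_def using \<alpha>(1) by (simp add: e_def ty_def g_def)
    moreover have "\<exists>P \<alpha>. valid_solution I P \<alpha>"
      using \<alpha>(2) by (auto simp: optimal_solution_def)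
    ultimately have "correct_output I (nupd ''feasible'' 0 1 \<tau>')"
      unfolding correct_output_def using \<alpha>(2) by auto
    moreover have "v + 4 \<le> t + 2300 * (n * k)"
    proof -
      have "1 \<le> n * k" "n \<le> n * k" using n by simp_all
      moreover have "v \<le> u + n * (100 * k + 100) + 100" using 1(1) by simp
      moreover have "n * (100 * k + 100) = 100 * (n * k) + 100 * n"
        "n * (1100 * k + 100) = 1100 * (n * k) + 100 * n"
        by (simp_all add: algebra_simps)
      ultimately show ?thesis
        using *(4) by linarith
    qed
    ultimately show ?case by simp
  qed
qed

end

section \<open>The complete algorithm\<close>

context jobs
begin

text \<open>Zeroed memory supplies the dummy phases in \<open>ma\<close> and \<open>ea\<close>, the
  starting point in cell 0 of \<open>last\<close>, and the flag of infeasible instances.\<close>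

lemma solve_prog_correct:
  assumes I: "represents I" and n: "0 < n" "0 < k" and "input \<sigma>"
    and zero: "\<And>x i. x \<notin> {''n'', ''k''} \<Longrightarrow> nmem \<sigma> x i = 0"
  shows "wp solve_prog (\<lambda>\<tau> u. correct_output I \<tau> \<and> u \<le> 3000 * (n * k)) \<sigma> 0"
proof -
  have nk: "nmem \<sigma> ''n'' 0 = n" "nmem \<sigma> ''k'' 0 = k"
    using assms(4) by (simp_all add: input_def)
  have "wp (Seq totals_prog (Seq copy_prog (Seq prev_prog (Cond (NLess (NConst 0) (NV ''bad'')) Skip
      (Seq (RPut ''top'' (RTimes (RV ''csum'') (RV ''ssum'')))
         (block [main_prog, trace_prog, NPut ''feasible'' (NConst 1)]))))))
     (\<lambda>\<tau> u. correct_output I \<tau> \<and> u \<le> 3000 * (n * k)) \<sigma> t" if "t \<le> 20" for t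
    unfolding wp_Seq[of totals_prog]
  proof (rule wp_conseq[OF totals_prog_correct[OF assms(4)]], goal_cases)
    case (1 \<tau>1 u1)
    have inp1: "input \<tau>1"
      using assms(4) 1(2) by (rule input_frame) (simp_all add: totals_prog_def)
    have z1: "nmem \<tau>1 x i = 0" if "x \<notin> {''n'', ''k'', ''a''}" for x i
      using 1(2) zero[of x i] that by (simp add: frame_def totals_prog_def)
    define wm where "wm = rmem \<tau>1 ''wmax'' 0"
    have wm: "w i \<le> wm \<longleftrightarrow> (\<exists>a\<in>{1..k}. w i \<le> W a)" for i
    proof -
      have "wm < w i \<longleftrightarrow> 0 < w i \<and> (\<forall>a\<in>{1..k}. W a < w i)"
        using 1(1) by (simp add: wm_def)
      \<comment> \<open>For weight 0, type 1 is a witness, since its threshold is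
        nonnegative.\<close>
      moreover have "1 \<in> {1..k}" using n by simp
      ultimately show ?thesis
        using W_nonneg[of 1] by (meson not_less order_trans)
    qed
    note tot = 1
    show ?case
      unfolding wp_Seq[of copy_prog]
    proof (rule wp_conseq[OF copy_prog_correct[OF inp1]], goal_cases)
      case (1 \<tau>2 u2)
      have inp2: "input \<tau>2"
        using inp1 1(2) by (rule input_frame) (simp_all add: copy_prog_def)
      have z2: "nmem \<tau>2 x i = 0" if "x \<notin> {''n'', ''k'', ''a'', ''bad'', ''j'', ''i''}" for x i
        using 1(2) z1[of x i] that by (simp add: frame_def copy_prog_def)
      have csum: "rmem \<tau>2 ''csum'' 0 = sum c {1..k}"
        using 1(2) tot(1) by (simp add: frame_def copy_prog_def)
      have bad: "nmem \<tau>2 ''bad'' 0 = 0 \<longleftrightarrow> (\<forall>i\<in>{1..n}. \<exists>a\<in>{1..k}. w i \<le> W a)"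
        using 1(1) wm by (simp flip: wm_def)
      note cop = 1
      have S: "\<forall>i\<in>{1..n}. rmem \<tau>2 ''S'' i = s i" using 1(1) by blast
      show ?case
        unfolding wp_Seq[of prev_prog]
      proof (rule wp_conseq[OF prev_prog_correct[OF inp2 S]], goal_cases)
        case (1 \<tau>3 u3)
        have inp3: "input \<tau>3"
          using inp2 1(2) by (rule input_frame) (simp_all add: prev_prog_def)
        have z3: "nmem \<tau>3 x i = 0"
          if "x \<notin> {''n'', ''k'', ''a'', ''bad'', ''j'', ''i'', ''p'', ''prev'', ''dep''}" for x i
          using 1(2) z2[of x i] that by (simp add: frame_def prev_prog_def)
        have same: "rmem \<tau>3 = rmem \<tau>2" "nmem \<tau>3 ''bad'' = nmem \<tau>2 ''bad''"
          using 1(2) by (auto simp: frame_def prev_prog_def)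
        have time: "u3 + 50 \<le> 700 * (n * k)"
        proof -
          have "1 \<le> n * k" "n \<le> n * k" "k \<le> n * k" using n by simp_all
          moreover have "u3 + 50 \<le> 60 * k + 170 * n + 300"
            using 1(1) cop(1) tot(1) that by simp
          ultimately show ?thesis by linarith
        qed
        show ?case
        proof (cases "nmem \<tau>3 ''bad'' 0 = 0")
          case True
          \<comment> \<open>\<open>bad = 0\<close> says exactly that every job can be processed
            alone.\<close>
          interpret feasible_jobs n k W c w s
            using True bad same(2) by unfold_locales simp
          define \<sigma>4 where "\<sigma>4 = rupd ''top'' 0 (sum c {1..k} * sum s {1..n}) \<tau>3"
          have "data \<sigma>4"
            using inp3 cop(1) 1(1) by (simp add: \<sigma>4_def data_def input_def same top_cost_def)
          have "wp (block [main_prog, trace_prog, NPut ''feasible'' (NConst 1)])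
            (\<lambda>\<tau> u. correct_output I \<tau> \<and> u \<le> 3000 * (n * k)) \<sigma>4 y" if "y \<le> u3 + 20" for y
            by (rule wp_conseq[OF optimize_correct[OF I \<open>data \<sigma>4\<close> n]])
              (use that time z3 in \<open>auto simp: \<sigma>4_def\<close>)
          then show ?thesis
            using True cop(1) by (simp add: \<sigma>4_def same csum)
        next
          case False
          then have "\<not> (\<exists>P \<alpha>. valid_solution I P \<alpha>)"
            using valid_solution_feasible[OF I] bad same(2) by metis
          then have "correct_output I \<tau>3"
            using z3 by (simp add: correct_output_def)
          then show ?thesis using False time by simp
        qed
      qed
    qed
  qed
  then show ?thesis
    using n nk by (simp add: solve_prog_def del: wp_Seq)
qed

end

lemma empty_instance:
  assumes "njobs I = 0" "nmem \<tau> ''groups'' 0 = 0" "nmem \<tau> ''feasible'' 0 = 1"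
  shows "correct_output I \<tau>"
proof -
  have "valid_solution I {} (\<lambda>_. 0)"
    using assms(1) by (simp add: valid_solution_def partition_on_empty)
  moreover have "total_cost I P \<alpha> = 0" if "valid_solution I P \<alpha>" for P \<alpha>
    using that assms(1) by (simp add: valid_solution_def partition_on_empty total_cost_def)
  ultimately have "optimal_solution I {} (\<lambda>_. 0)"
    by (simp add: optimal_solution_def total_cost_def)
  moreover have "output_solution \<tau> {} (\<lambda>_. 0)"
    using assms(2) by (simp add: output_solution_def)
  ultimately show ?thesis
    using \<open>valid_solution I {} _\<close> assms(3) unfolding correct_output_def by auto
qed

lemma no_types_instance:
  assumes "0 < njobs I" "ntypes I = 0" "nmem \<tau> ''feasible'' 0 = 0"
  shows "correct_output I \<tau>"
proof -
  have "\<not> valid_solution I P \<alpha>" for P \<alpha>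
  proof
    assume v: "valid_solution I P \<alpha>"
    then have "P = {}" using assms(2) by (auto simp: valid_solution_def)
    with v assms(1) show False by (simp add: valid_solution_def partition_on_def)
  qed
  with assms(3) show ?thesis by (simp add: correct_output_def)
qed

theorem theorem1:
  "\<exists>(prog :: com) (C :: nat). solves_within prog (\<lambda>n k. C * max 1 (n * k))"
proof (intro exI)
  \<comment> \<open>The maximum with 1 allows for the constant time spent when
    \<open>n * k = 0\<close>.\<close>
  show "solves_within solve_prog (\<lambda>n k. 3000 * max 1 (n * k))"
    unfolding solves_within_def
  proof (intro allI impI)
    fix I assume I: "nonneg_inst I"
    let ?\<sigma> = "initial_state I"
    let ?n = "njobs I" and ?k = "ntypes I"
    have "wp solve_prog (\<lambda>\<tau> u. correct_output I \<tau> \<and> u \<le> 3000 * max 1 (?n * ?k)) ?\<sigma> 0"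
    proof (cases "?n = 0 \<or> ?k = 0")
      case True
      then consider "?n = 0" | "0 < ?n" "?k = 0" by auto
      then show ?thesis
      proof cases
        case 1
        then show ?thesis
          by (simp add: solve_prog_def initial_state_def empty_instance)
      next
        case 2
        then show ?thesis
          by (simp add: solve_prog_def initial_state_def no_types_instance)
      qed
    next
      case False
      \<comment> \<open>The index \<open>n + 1 - j\<close> reverses the jobs. Cells outside the
        input hold 0, so the sign conditions hold at all indices.\<close>
      interpret jobs ?n ?k "rmem ?\<sigma> ''w0''" "rmem ?\<sigma> ''c''"
        "\<lambda>j. rmem ?\<sigma> ''w'' (?n + 1 - j)" "\<lambda>j. rmem ?\<sigma> ''s'' (?n + 1 - j)"
        using I by unfold_locales (auto simp: nonneg_inst_def initial_state_def)
      have "represents I"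
        unfolding represents_def by (auto simp: initial_state_def)
      moreover have "input ?\<sigma>"
        unfolding input_def by (simp add: initial_state_def)
      ultimately show ?thesis
        using False by (intro wp_conseq[OF solve_prog_correct]) (auto simp: initial_state_def)
    qed
    then show "\<exists>t \<tau>. exec solve_prog ?\<sigma> t \<tau> \<and> t \<le> 3000 * max 1 (?n * ?k) \<and> correct_output I \<tau>"
      unfolding wp_def by auto
  qed
qed

end
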